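(* Let $D\subset\mathbb R^2$ be a domain, with coordinates $(x,y)$, which contains the origin. Let $\phi:D\to\mathbb R$ be smooth, and let $U:D\to\widetilde\Lambda SU(2)$ be smooth with $$\frac{\partial U}{\partial x}=\frac{i}{2}U\begin{bmatrix} -\phi_x & \lambda \\ \lambda & \phi_x \end{bmatrix},\qquad\frac{\partial U}{\partial y}=-\frac{i}{2\lambda}U\begin{bmatrix} 0 & e^{i\phi} \\ e^{-i\phi} & 0 \end{bmatrix},$$ and $U(0,0;\lambda)=I$ for all $\lambda$. Let $$U=U^X_+V_-=U^Y_-V_+$$ be the two Birkhoff decompositions of $U$, with $U^X_+\in\Lambda^+_*SU(2)$, $V_-\in\Lambda^-SU(2)$, $U^Y_-\in\Lambda^-_*SU(2)$, $V_+\in\Lambda^+SU(2)$ (where $U^X_+$ does not depend on $y$ and $U^Y_-$ does not depend on $x$). Then $$(U^X_+)^{-1}\frac{\partial U^X_+}{\partial x}=\frac{i}{2}\lambda\begin{bmatrix} 0 & e^{-i\alpha(x)} \\ e^{i\alpha(x)} & 0 \end{bmatrix},\qquad \alpha(x)=\phi(x,0)-\phi(0,0),$$ and $$(U^Y_-)^{-1}\frac{\partial U^Y_-}{\partial y}=-\frac{i}{2\lambda}\begin{bmatrix} 0 & e^{i\beta(y)} \\ e^{-i\beta(y)} & 0 \end{bmatrix},\qquad \beta(y)=\phi(0,y).$$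
   Context: $\mathbb R^*=\mathbb R\setminus\{0\}$, $\mathbb C^*=\mathbb C\setminus\{0\}$, $\sigma_3=\operatorname{diag}(1,-1)$. $\widetilde\Lambda SU(2)$ is the group of maps $g:\mathbb R^*\to SU(2)$ satisfying the twisting condition $g(-\lambda)=\sigma_3\,g(\lambda)\,\sigma_3^{-1}$ which extend to analytic maps $\mathbb C^*\to SL(2,\mathbb C)$. $\Lambda^+SU(2)$ (resp. $\Lambda^-SU(2)$) is the subgroup of those $g$ with expansion $g=g_0+\lambda g_1+\lambda^2g_2+\cdots$ (resp. $g=g_0+\lambda^{-1}g_1+\lambda^{-2}g_2+\cdots$); $\Lambda^\pm_*SU(2)$ is the subgroup of $\Lambda^\pm SU(2)$ with $g_0=I$. Known fact (Birkhoff decomposition; may be used): the multiplication maps $\Lambda^+_*SU(2)\times\Lambda^-SU(2)\to\widetilde\Lambda SU(2)$ and $\Lambda^-_*SU(2)\times\Lambda^+SU(2)\to\widetilde\Lambda SU(2)$ are diffeomorphisms, so the two decompositions of $U$ exist, are unique, and depend smoothly on $(x,y)$. *)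

theory Defs
  imports "HOL-Analysis.Analysis"
begin

section \<open>Smooth maps on open sets\<close>

text \<open>The derivative is the Frechet derivative over the reals, so the following two notions are
  meant for open \<^term>\<open>S\<close> only.\<close>

fun Ck_on :: "nat \<Rightarrow> 'a::real_normed_vector set \<Rightarrow> ('a \<Rightarrow> 'b::real_normed_vector) \<Rightarrow> bool" where
  "Ck_on 0 S f \<longleftrightarrow> continuous_on S f"
| "Ck_on (Suc k) S f \<longleftrightarrow>
     f differentiable_on S \<and> (\<forall>v. Ck_on k S (\<lambda>x. frechet_derivative f (at x) v))"

definition smooth_on :: "'a::real_normed_vector set \<Rightarrow> ('a \<Rightarrow> 'b::real_normed_vector) \<Rightarrow> bool" where
  "smooth_on S f \<longleftrightarrow> (\<forall>k. Ck_on k S f)"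


section \<open>Complex two by two matrices\<close>

type_synonym cmat2 = "complex^2^2"

definition mat2 :: "complex \<Rightarrow> complex \<Rightarrow> complex \<Rightarrow> complex \<Rightarrow> cmat2" where
  "mat2 a b c d = vector [vector [a, b], vector [c, d]]"

definition cscale :: "complex \<Rightarrow> cmat2 \<Rightarrow> cmat2" where
  "cscale c A = map_matrix (\<lambda>z. c * z) A"

definition conj_transpose :: "cmat2 \<Rightarrow> cmat2" where
  "conj_transpose A = map_matrix cnj (transpose A)"

definition SU2 :: "cmat2 set" where
  "SU2 = {A. A ** conj_transpose A = mat 1 \<and> det A = 1}"

definition SL2C :: "cmat2 set" where
  "SL2C = {A. det A = 1}"

definition \<sigma>3 :: cmat2 where
  "\<sigma>3 = mat2 1 0 0 (-1)"


section \<open>Loop groups\<close>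

text \<open>A loop is a function of a real parameter. Its value at the parameter \<^term>\<open>0::real\<close> is
  arbitrary: every condition below is restricted to nonzero parameters, and equality of loops
  always means equality at all nonzero parameters.\<close>

type_synonym loop = "real \<Rightarrow> cmat2"

definition analytic_extension :: "loop \<Rightarrow> (complex \<Rightarrow> cmat2) \<Rightarrow> bool" where
  "analytic_extension g G \<longleftrightarrow>
     (\<forall>i j. (\<lambda>z. G z $ i $ j) analytic_on -{0}) \<and>
     (\<forall>z. z \<noteq> 0 \<longrightarrow> G z \<in> SL2C) \<and>
     (\<forall>t. t \<noteq> 0 \<longrightarrow> G (of_real t) = g t)"

definition Loop_SU2 :: "loop set" where
  "Loop_SU2 = {g.
     (\<forall>t. t \<noteq> 0 \<longrightarrow> g t \<in> SU2) \<and>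
     (\<forall>t. t \<noteq> 0 \<longrightarrow> g (-t) = \<sigma>3 ** g t ** matrix_inv \<sigma>3) \<and>
     (\<exists>G. analytic_extension g G)}"

definition plus_expansion :: "loop \<Rightarrow> (nat \<Rightarrow> cmat2) \<Rightarrow> bool" where
  "plus_expansion g c \<longleftrightarrow> (\<forall>t. t \<noteq> 0 \<longrightarrow> (\<lambda>n. t ^ n *\<^sub>R c n) sums g t)"

definition minus_expansion :: "loop \<Rightarrow> (nat \<Rightarrow> cmat2) \<Rightarrow> bool" where
  "minus_expansion g c \<longleftrightarrow> (\<forall>t. t \<noteq> 0 \<longrightarrow> (\<lambda>n. inverse t ^ n *\<^sub>R c n) sums g t)"

definition Loop_plus :: "loop set" where
  "Loop_plus = {g \<in> Loop_SU2. \<exists>c. plus_expansion g c}"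

definition Loop_minus :: "loop set" where
  "Loop_minus = {g \<in> Loop_SU2. \<exists>c. minus_expansion g c}"

definition Loop_plus_normalized :: "loop set" where
  "Loop_plus_normalized = {g \<in> Loop_SU2. \<exists>c. plus_expansion g c \<and> c 0 = mat 1}"

definition Loop_minus_normalized :: "loop set" where
  "Loop_minus_normalized = {g \<in> Loop_SU2. \<exists>c. minus_expansion g c \<and> c 0 = mat 1}"


section \<open>Loop-valued maps on a plane domain\<close>

text \<open>The loop group carries the topology of locally uniform convergence of the (unique) analytic
  extensions to the punctured complex plane. A map into it is smooth precisely when the extensions
  are jointly smooth in the point and the complex parameter.\<close>

definition smooth_loop_map :: "(real \<times> real) set \<Rightarrow> (real \<times> real \<Rightarrow> loop) \<Rightarrow> bool" where
  "smooth_loop_map D F \<longleftrightarrow>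
     (\<exists>G. (\<forall>p\<in>D. analytic_extension (F p) (G p)) \<and>
          smooth_on (D \<times> -{0}) (\<lambda>(p, z). G p z))"

definition partial_x :: "(real \<times> real \<Rightarrow> loop) \<Rightarrow> real \<times> real \<Rightarrow> loop" where
  "partial_x F p t = vector_derivative (\<lambda>s. F (s, snd p) t) (at (fst p))"

definition partial_y :: "(real \<times> real \<Rightarrow> loop) \<Rightarrow> real \<times> real \<Rightarrow> loop" where
  "partial_y F p t = vector_derivative (\<lambda>s. F (fst p, s) t) (at (snd p))"

definition indep_of_y :: "(real \<times> real) set \<Rightarrow> (real \<times> real \<Rightarrow> loop) \<Rightarrow> bool" where
  "indep_of_y S F \<longleftrightarrow>
     (\<forall>x y y' t. (x, y) \<in> S \<longrightarrow> (x, y') \<in> S \<longrightarrow> t \<noteq> 0 \<longrightarrow> F (x, y) t = F (x, y') t)"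

definition indep_of_x :: "(real \<times> real) set \<Rightarrow> (real \<times> real \<Rightarrow> loop) \<Rightarrow> bool" where
  "indep_of_x S F \<longleftrightarrow>
     (\<forall>x x' y t. (x, y) \<in> S \<longrightarrow> (x', y) \<in> S \<longrightarrow> t \<noteq> 0 \<longrightarrow> F (x, y) t = F (x', y) t)"

text \<open>On a domain whose horizontal and vertical slices are disconnected, the two normalized
  Birkhoff factors are independent of the other coordinate on each slice component only, and then
  the values of the angle on the axes need not determine them. A point at which the factors can be
  read off from the axis is either joined to the origin by an axis-parallel path in the domain
  (first along the indicated axis), or the factors are independent of the other coordinate on the
  whole domain. For domains with connected slices, both alternatives are automatic as soon as the
  foot point on the axis lies in the domain.\<close>

definition over_x_axis ::
  "(real \<times> real) set \<Rightarrow> (real \<times> real \<Rightarrow> loop) \<Rightarrow> (real \<times> real \<Rightarrow> loop) \<Rightarrow> real \<Rightarrow> real \<Rightarrow> bool" where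
  "over_x_axis D UX UY x y \<longleftrightarrow>
     (closed_segment (0, 0) (x, 0) \<subseteq> D \<and> closed_segment (x, 0) (x, y) \<subseteq> D) \<or>
     ((x, 0) \<in> D \<and> (x, y) \<in> D \<and> indep_of_y D UX \<and> indep_of_x D UY)"

definition over_y_axis ::
  "(real \<times> real) set \<Rightarrow> (real \<times> real \<Rightarrow> loop) \<Rightarrow> (real \<times> real \<Rightarrow> loop) \<Rightarrow> real \<Rightarrow> real \<Rightarrow> bool" where
  "over_y_axis D UX UY x y \<longleftrightarrow>
     (closed_segment (0, 0) (0, y) \<subseteq> D \<and> closed_segment (0, y) (x, y) \<subseteq> D) \<or>
     ((0, y) \<in> D \<and> (x, y) \<in> D \<and> indep_of_y D UX \<and> indep_of_x D UY)"

end

theory Submission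
  imports Defs "HOL-Complex_Analysis.Conformal_Mappings"
begin

text \<open>Differentiating \<open>U = U\<^sup>X\<^sub>+ V\<^sub>-\<close> expresses the logarithmic derivative of \<open>U\<^sup>X\<^sub>+\<close> through \<open>V\<^sub>-\<close>. The
  former is entire and vanishes at \<open>\<lambda> = 0\<close>, the latter grows at most linearly at infinity, so by
  Liouville \<open>U\<^sup>X\<^sub>+\<close> is constant in \<open>y\<close>, and its logarithmic derivative in \<open>x\<close> is \<open>\<lambda>\<close> times the leading
  coefficient of the potential conjugated by the diagonal matrix \<open>v = V\<^sub>-(\<lambda> = \<infinity>)\<close>; likewise for
  \<open>U\<^sup>Y\<^sub>-\<close> with \<open>w = V\<^sub>+(\<lambda> = 0)\<close>.

  The squares of \<open>v\<close> and \<open>w\<close> on the axes are found without solving the differential equation. At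
  \<open>(x, 0)\<close> we have \<open>U\<^sup>Y\<^sub>- = I\<close>, as at the origin, so \<open>U\<^sup>X\<^sub>+ V\<^sub>- = V\<^sub>+\<close>, which forces \<open>V\<^sub>-\<close> to be
  constant in \<open>\<lambda>\<close> and \<open>v = w\<close>; and the logarithmic \<open>y\<close>-derivative of \<open>U\<^sup>Y\<^sub>-\<close>, which determines
  \<open>w\<^sup>2 e\<^sup>i\<^sup>\<phi>\<close>, is the same at \<open>(x, 0)\<close> and at the origin, where \<open>w = I\<close>. The \<open>y\<close>-axis is symmetric.\<close>

section \<open>Entire functions depending on a parameter\<close>

text \<open>On the compact set \<open>{-e/2..e/2} \<times> C\<close> the derivative is uniformly
  continuous, so the mean value inequality bounds the error of the difference quotient by the
  oscillation of \<open>f' s z\<close> in \<open>s\<close>, with one bound for all \<open>z\<close>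
  in \<open>C\<close>.\<close>

lemma uniform_limit_difference_quotient:
  fixes f f' :: "real \<Rightarrow> complex \<Rightarrow> complex"
  assumes e: "e > 0" and C: "compact C"
    and der: "\<And>s z. \<bar>s\<bar> < e \<Longrightarrow> z \<in> C \<Longrightarrow> ((\<lambda>s. f s z) has_vector_derivative f' s z) (at s)"
    and cont: "continuous_on ({-e<..<e} \<times> C) (\<lambda>(s, z). f' s z)"
    and h: "h \<longlonglongrightarrow> 0" and h0: "\<And>n. h n \<noteq> 0"
  shows "uniform_limit C (\<lambda>n z. (f (h n) z - f 0 z) / of_real (h n)) (f' 0) sequentially"
proof (rule uniform_limitI)
  fix \<epsilon> :: real assume \<epsilon>: "\<epsilon> > 0"
  have "uniformly_continuous_on ({-e/2..e/2} \<times> C) (\<lambda>(s, z). f' s z)"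
    by (intro compact_uniformly_continuous continuous_on_subset[OF cont] compact_Times C)
       (use e in auto)
  then obtain d where d: "d > 0" and
    dd: "\<And>p q. p \<in> {-e/2..e/2} \<times> C \<Longrightarrow> q \<in> {-e/2..e/2} \<times> C \<Longrightarrow> dist q p < d \<Longrightarrow>
       dist ((\<lambda>(s, z). f' s z) q) ((\<lambda>(s, z). f' s z) p) < \<epsilon> / 2"
    unfolding uniformly_continuous_on_def using \<epsilon> by (metis half_gt_zero)
  have "\<forall>\<^sub>F n in sequentially. dist (h n) 0 < min d (e / 2)"
    using h d e by (intro tendstoD) auto
  then show "\<forall>\<^sub>F n in sequentially. \<forall>z\<in>C.
      dist ((f (h n) z - f 0 z) / of_real (h n)) (f' 0 z) < \<epsilon>"
  proof (eventually_elim, intro ballI)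
    fix n z assume hn: "dist (h n) 0 < min d (e / 2)" and z: "z \<in> C"
    have seg: "\<bar>s\<bar> \<le> \<bar>h n\<bar>" if "s \<in> closed_segment 0 (h n)" for s
      using that by (auto simp: closed_segment_eq_real_ivl split: if_splits)
    have "norm (f (h n) z - f 0 z - (h n - 0) *\<^sub>R f' 0 z) \<le> norm (h n - 0) * (\<epsilon> / 2)"
    proof (rule vector_differentiable_bound_linearization[where S = "closed_segment 0 (h n)"])
      fix s assume s: "s \<in> closed_segment 0 (h n)"
      show "((\<lambda>s. f s z) has_vector_derivative f' s z) (at s within closed_segment 0 (h n))"
        by (rule has_vector_derivative_at_within, rule der) (use seg[OF s] hn e z in auto)
      show "norm (f' s z - f' 0 z) \<le> \<epsilon> / 2"
      proof -
        have "-e/2 \<le> s" "s \<le> e/2" "\<bar>s\<bar> < d"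
          using seg[OF s] hn by (auto simp: dist_norm)
        then show ?thesis
          using dd[of "(0, z)" "(s, z)"] e z by (auto simp: dist_norm dist_Pair_Pair)
      qed
    qed auto
    moreover have "f (h n) z - f 0 z - (h n - 0) *\<^sub>R f' 0 z
        = ((f (h n) z - f 0 z) / of_real (h n) - f' 0 z) * of_real (h n)"
      using h0[of n] by (simp add: scaleR_conv_of_real field_simps)
    ultimately have "norm ((f (h n) z - f 0 z) / of_real (h n) - f' 0 z) \<le> \<epsilon> / 2"
      using h0[of n] by (simp add: norm_mult mult.commute[of "\<bar>h n\<bar>"])
    then show "dist ((f (h n) z - f 0 z) / of_real (h n)) (f' 0 z) < \<epsilon>"
      using \<epsilon> by (simp add: dist_norm)
  qed
qed

text \<open>The maximum modulus principle for \<open>q m z - q n z\<close> carries the estimate from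
  the circle to the disc. This is how convergence crosses the point 0, where no derivative in the
  parameter is available.\<close>

lemma uniformly_Cauchy_on_cball:
  fixes q :: "nat \<Rightarrow> complex \<Rightarrow> complex"
  assumes hol: "\<And>n. q n holomorphic_on UNIV" and ca: "uniformly_Cauchy_on (sphere 0 R) q"
  shows "uniformly_Cauchy_on (cball 0 R) q"
proof (rule uniformly_Cauchy_onI)
  fix \<epsilon> :: real assume \<epsilon>: "\<epsilon> > 0"
  then obtain M where M: "\<And>z m n. z \<in> sphere 0 R \<Longrightarrow> m \<ge> M \<Longrightarrow> n \<ge> M \<Longrightarrow> dist (q m z) (q n z) < \<epsilon> / 2"
    using ca unfolding uniformly_Cauchy_on_def by (meson half_gt_zero)
  have "dist (q m z) (q n z) < \<epsilon>" if mn: "m \<ge> M" "n \<ge> M" and z: "z \<in> cball 0 R" for m n z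
  proof -
    have "norm (q m z - q n z) \<le> \<epsilon> / 2"
    proof (rule maximum_modulus_frontier[where S = "cball 0 R" and f = "\<lambda>z. q m z - q n z"])
      have h: "(\<lambda>z. q m z - q n z) holomorphic_on UNIV"
        by (intro holomorphic_intros hol)
      show "(\<lambda>z. q m z - q n z) holomorphic_on interior (cball 0 R)"
        by (rule holomorphic_on_subset[OF h]) auto
      show "continuous_on (closure (cball 0 R)) (\<lambda>z. q m z - q n z)"
        using h holomorphic_on_imp_continuous_on continuous_on_subset by blast
    qed (use M[OF _ mn] z in \<open>auto simp: dist_norm less_imp_le\<close>)
    then show ?thesis using \<epsilon> by (simp add: dist_norm)
  qed
  then show "\<exists>M. \<forall>x\<in>cball 0 R. \<forall>m\<ge>M. \<forall>n\<ge>M. dist (q m x) (q n x) < \<epsilon>"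
    by blast
qed

text \<open>The difference quotients in \<open>s\<close> are entire in \<open>z\<close>. They
  converge uniformly on circles around 0, hence on discs, so their limit \<open>K\<close> is entire
  and fills the puncture. The last conclusion is the form in which a normalisation at 0 survives
  differentiation: quotients of a constant vanish.\<close>

lemma parameter_derivative_entire:
  fixes f f' :: "real \<Rightarrow> complex \<Rightarrow> complex"
  assumes e: "e > 0" and hol: "\<And>s. \<bar>s\<bar> < e \<Longrightarrow> f s holomorphic_on UNIV"
    and der: "\<And>s z. \<bar>s\<bar> < e \<Longrightarrow> z \<noteq> 0 \<Longrightarrow> ((\<lambda>s. f s z) has_vector_derivative f' s z) (at s)"
    and cont: "continuous_on ({-e<..<e} \<times> -{0}) (\<lambda>(s, z). f' s z)"
  obtains K where "K holomorphic_on UNIV" "\<And>z. z \<noteq> 0 \<Longrightarrow> K z = f' 0 z"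
    "\<And>c. (\<And>s. \<bar>s\<bar> < e \<Longrightarrow> f s 0 = c) \<Longrightarrow> K 0 = 0"
proof -
  \<comment> \<open>The shift by 2 keeps every \<open>h n\<close>, also for \<open>n = 0\<close>,
    strictly between 0 and \<open>e\<close>.\<close>
  define h where "h n = e / (real n + 2)" for n :: nat
  have h0: "h n \<noteq> 0" and he: "\<bar>h n\<bar> < e" for n
    using e by (auto simp: h_def field_simps add_pos_nonneg)
  have hlim: "h \<longlonglongrightarrow> 0"
    unfolding h_def by real_asymp
  define q where "q n z = (f (h n) z - f 0 z) / of_real (h n)" for n z
  define K where "K z = lim (\<lambda>n. q n z)" for z
  have qhol: "q n holomorphic_on UNIV" for n
    unfolding q_def using h0[of n] he[of n] e by (intro holomorphic_intros hol) auto
  have ul: "uniform_limit C q (f' 0) sequentially" if "compact C" "C \<subseteq> -{0}" for C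
    unfolding q_def using that
    by (intro uniform_limit_difference_quotient[OF e] der continuous_on_subset[OF cont] hlim h0) auto
  have Kul: "uniform_limit (cball 0 R) q K sequentially" if "R > 0" for R
  proof -
    have "uniformly_Cauchy_on (sphere 0 R) q"
      using ul[of "sphere 0 R"] that
      by (intro uniformly_convergent_Cauchy) (auto simp: uniformly_convergent_on_def)
    then have "uniformly_convergent_on (cball 0 R) q"
      by (intro Cauchy_uniformly_convergent uniformly_Cauchy_on_cball qhol)
    then show ?thesis
      unfolding uniformly_convergent_uniform_limit_iff K_def .
  qed
  show ?thesis
  proof
    show "K holomorphic_on UNIV"
    proof (rule holomorphic_uniform_sequence[OF open_UNIV qhol])
      fix z :: complex
      have "cball z 1 \<subseteq> cball 0 (norm z + 1)"
        by (simp add: cball_subset_cball_iff)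
      then show "\<exists>d. 0 < d \<and> cball z d \<subseteq> UNIV \<and> uniform_limit (cball z d) q K sequentially"
        using uniform_limit_on_subset[OF Kul, of "norm z + 1" "cball z 1"]
        by (intro exI[of _ 1]) (auto simp: add_nonneg_pos)
    qed
    show "K z = f' 0 z" if "z \<noteq> 0" for z
      unfolding K_def using tendsto_uniform_limitI[OF ul[of "{z}"], of z] that
      by (intro limI) auto
    show "K 0 = 0" if "\<And>s. \<bar>s\<bar> < e \<Longrightarrow> f s 0 = c" for c
      using that[of 0] that[OF he] e by (simp add: K_def q_def)
  qed
qed

text \<open>Identity theorem, with 1 as accumulation point of the positive reals. Since 0 is
  avoided, the same argument serves the plane and the punctured plane.\<close>

lemma holomorphic_eq_on_pos_reals_imp_eq:
  fixes f g :: "complex \<Rightarrow> complex"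
  assumes f: "f holomorphic_on S" and g: "g holomorphic_on S"
    and S: "open S" "connected S" "of_real ` {0<..} \<subseteq> S"
    and eq: "\<And>t::real. t > 0 \<Longrightarrow> f (of_real t) = g (of_real t)" and "z \<in> S"
  shows "f z = g z"
proof -
  have "(\<lambda>z. f z - g z) z = 0"
  proof (rule analytic_continuation[where f = "\<lambda>z. f z - g z"])
    show "(\<lambda>z. f z - g z) holomorphic_on S"
      using f g by (intro holomorphic_intros)
    show "1 \<in> S"
      using S(3) by (auto simp: image_subset_iff dest: bspec[of _ _ 1])
    show "(1::complex) islimpt of_real ` {0<..}"
      unfolding islimpt_approachable
    proof (intro allI impI)
      fix e :: real assume "e > 0"
      then show "\<exists>x'\<in>of_real ` {0<..}. x' \<noteq> (1::complex) \<and> dist x' 1 < e"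
        by (intro bexI[of _ "of_real (1 + e / 2)"] image_eqI[of _ _ "1 + e / 2"])
           (auto simp: dist_norm)
    qed
  qed (use S eq \<open>z \<in> S\<close> in auto)
  then show ?thesis by simp
qed

lemma holomorphic_punctured_eq_on_reals_imp_eq:
  fixes f g :: "complex \<Rightarrow> complex"
  assumes "f holomorphic_on -{0}" "g holomorphic_on -{0}"
    and "\<And>t::real. t \<noteq> 0 \<Longrightarrow> f (of_real t) = g (of_real t)" and "z \<noteq> 0"
  shows "f z = g z"
  by (rule holomorphic_eq_on_pos_reals_imp_eq[of f "-{0}" g])
     (use assms in \<open>auto intro!: connected_punctured_universe\<close>)

lemma entire_eq_on_reals_imp_eq:
  fixes f g :: "complex \<Rightarrow> complex"
  assumes "f holomorphic_on UNIV" "g holomorphic_on UNIV"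
    and "\<And>t::real. t \<noteq> 0 \<Longrightarrow> f (of_real t) = g (of_real t)"
  shows "f z = g z"
  by (rule holomorphic_eq_on_pos_reals_imp_eq[of f UNIV g]) (use assms in auto)

text \<open>By the identity theorem the relation holds for all nonzero complex \<open>z\<close>, so
  \<open>f z\<close> tends to \<open>g 0\<close> at infinity and Liouville applies. Series in
  negative powers are encoded throughout as entire functions of the reciprocal variable; this is the
  scalar form of the fact that a loop with both kinds of expansion is constant.\<close>

lemma entire_eq_inverse_imp_const:
  fixes f g :: "complex \<Rightarrow> complex"
  assumes f: "f holomorphic_on UNIV" and g: "g holomorphic_on UNIV"
    and eq: "\<And>t::real. t \<noteq> 0 \<Longrightarrow> f (of_real t) = g (inverse (of_real t))"
  shows "f z = g 0"
proof (rule Liouville_weak[OF f])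
  have "isCont g 0"
    using holomorphic_on_imp_continuous_on[OF g] by (simp add: continuous_on_eq_continuous_at)
  then have lim: "((\<lambda>z. g (inverse z)) \<longlongrightarrow> g 0) at_infinity"
    by (rule isCont_tendsto_compose) (rule tendsto_inverse_0)
  have fg: "f z = g (inverse z)" if "z \<noteq> 0" for z
  proof (rule holomorphic_punctured_eq_on_reals_imp_eq[where g = "\<lambda>z. g (inverse z)", OF _ _ eq that])
    show "f holomorphic_on - {0}" using f holomorphic_on_subset by blast
    show "(\<lambda>z. g (inverse z)) holomorphic_on - {0}"
      by (rule holomorphic_on_compose_gen[OF _ g, unfolded o_def]) (auto intro!: holomorphic_intros)
  qed simp
  have "\<forall>\<^sub>F z in at_infinity. g (inverse z) = f z"
    unfolding eventually_at_infinity
  proof (intro exI[of _ 1] allI impI)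
    fix z :: complex assume "1 \<le> norm z"
    then have "z \<noteq> 0" by auto
    then show "g (inverse z) = f z" by (simp add: fg)
  qed
  then show "(f \<longlongrightarrow> g 0) at_infinity"
    by (rule Lim_transform_eventually[OF lim])
qed

text \<open>The zero of \<open>f\<close> at 0 makes \<open>f z / z\<close> entire once its removable
  singularity is filled with \<open>deriv f 0\<close>, which reduces the claim to the constant
  case.\<close>

lemma entire_eq_mult_inverse_imp_linear:
  fixes f g :: "complex \<Rightarrow> complex"
  assumes f: "f holomorphic_on UNIV" and g: "g holomorphic_on UNIV" and "f 0 = 0"
    and eq: "\<And>t::real. t \<noteq> 0 \<Longrightarrow> f (of_real t) = of_real t * g (inverse (of_real t))"
  shows "f z = z * g 0"
proof (cases "z = 0")
  case False
  define q where "q z = (if z = 0 then deriv f 0 else f z / z)" for z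
  have "q holomorphic_on UNIV"
    by (rule pole_theorem_open_0[OF f, of 0]) (auto simp: q_def \<open>f 0 = 0\<close>)
  then have "q z = g 0"
    by (rule entire_eq_inverse_imp_const[OF _ g]) (auto simp: q_def eq)
  with False show ?thesis by (auto simp: q_def field_simps)
qed (use assms in auto)

section \<open>Entire matrix functions\<close>

lemma cscale_nth [simp]: "cscale c A $ i $ j = c * A $ i $ j"
  by (simp add: cscale_def map_matrix_def)

lemma mat2_nth [simp]:
  "mat2 a b c d $ 1 $ 1 = a" "mat2 a b c d $ 1 $ 2 = b"
  "mat2 a b c d $ 2 $ 1 = c" "mat2 a b c d $ 2 $ 2 = d"
  by (simp_all add: mat2_def)

text \<open>The adjugate: the inverse of a matrix of determinant 1, with entries linear in those of
  \<open>A\<close>, so that inverting an entire matrix function visibly keeps it entire.\<close>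

definition adj2 :: "cmat2 \<Rightarrow> cmat2" where
  "adj2 A = mat2 (A $ 2 $ 2) (- A $ 1 $ 2) (- A $ 2 $ 1) (A $ 1 $ 1)"

lemma mult_nth2:
  fixes A B :: cmat2
  shows "(A ** B) $ i $ j = A $ i $ 1 * B $ 1 $ j + A $ i $ 2 * B $ 2 $ j"
  by (simp add: matrix_matrix_mult_def sum_2)

lemma cmat2_eq_iff:
  "(A :: cmat2) = B \<longleftrightarrow> A $ 1 $ 1 = B $ 1 $ 1 \<and> A $ 1 $ 2 = B $ 1 $ 2 \<and>
     A $ 2 $ 1 = B $ 2 $ 1 \<and> A $ 2 $ 2 = B $ 2 $ 2"
  unfolding vec_eq_iff forall_2 by blast

lemma mat_1_nth2 [simp]:
  "(mat 1 :: cmat2) $ 1 $ 1 = 1" "(mat 1 :: cmat2) $ 1 $ 2 = 0"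
  "(mat 1 :: cmat2) $ 2 $ 1 = 0" "(mat 1 :: cmat2) $ 2 $ 2 = 1"
  by (simp_all add: mat_def)

lemma adj2_inverse:
  assumes "det A = 1"
  shows "A ** adj2 A = mat 1" "adj2 A ** A = mat 1"
  using assms by (auto simp: cmat2_eq_iff mult_nth2 adj2_def det_2 algebra_simps)

lemma adj2_mat_1 [simp]: "adj2 (mat 1) = mat 1"
  by (simp add: cmat2_eq_iff adj2_def)

lemma matrix_inv_eqI:
  fixes A B :: cmat2
  assumes "A ** B = mat 1" "B ** A = mat 1"
  shows "matrix_inv A = B"
proof -
  have "A ** matrix_inv A = mat 1 \<and> matrix_inv A ** A = mat 1"
    unfolding matrix_inv_def by (rule someI[of _ B]) (use assms in auto)
  then show ?thesis
    by (metis assms(2) matrix_mul_assoc matrix_mul_lid matrix_mul_rid)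
qed

lemma bounded_bilinear_cmat2_mult: "bounded_bilinear ((**) :: cmat2 \<Rightarrow> cmat2 \<Rightarrow> cmat2)"
  unfolding bilinear_conv_bounded_bilinear[symmetric] bilinear_def
  by (auto intro!: linearI simp: cmat2_eq_iff mult_nth2 algebra_simps)

definition entire_mat :: "(complex \<Rightarrow> cmat2) \<Rightarrow> bool" where
  "entire_mat M \<longleftrightarrow> (\<forall>i j. (\<lambda>z. M z $ i $ j) holomorphic_on UNIV)"

lemma entire_mat_nth: "entire_mat M \<Longrightarrow> (\<lambda>z. M z $ i $ j) holomorphic_on UNIV"
  by (simp add: entire_mat_def)

lemma entire_mat_const [intro]: "entire_mat (\<lambda>z. A)"
  by (simp add: entire_mat_def)

lemma entire_mat_mult [intro]: "entire_mat A \<Longrightarrow> entire_mat B \<Longrightarrow> entire_mat (\<lambda>z. A z ** B z)"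
  by (auto simp: entire_mat_def mult_nth2 intro!: holomorphic_intros)

lemma entire_mat_add [intro]: "entire_mat A \<Longrightarrow> entire_mat B \<Longrightarrow> entire_mat (\<lambda>z. A z + B z)"
  by (auto simp: entire_mat_def intro!: holomorphic_intros)

lemma entire_mat_diff [intro]: "entire_mat A \<Longrightarrow> entire_mat B \<Longrightarrow> entire_mat (\<lambda>z. A z - B z)"
  by (auto simp: entire_mat_def intro!: holomorphic_intros)

lemma entire_mat_cscale [intro]:
  "f holomorphic_on UNIV \<Longrightarrow> entire_mat A \<Longrightarrow> entire_mat (\<lambda>z. cscale (f z) (A z))"
  by (auto simp: entire_mat_def intro!: holomorphic_intros)

lemma entire_mat_adj2 [intro]: "entire_mat A \<Longrightarrow> entire_mat (\<lambda>z. adj2 (A z))"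
  by (auto simp: entire_mat_def forall_2 adj2_def intro!: holomorphic_intros)

lemma entire_mat_eq_inverse_imp_const:
  assumes "entire_mat A" "entire_mat B"
    and "\<And>t::real. t \<noteq> 0 \<Longrightarrow> A (of_real t) = B (inverse (of_real t))"
  shows "A z = B 0"
proof -
  have "A z $ i $ j = B 0 $ i $ j" for i j
    by (rule entire_eq_inverse_imp_const[OF entire_mat_nth[OF assms(1), of i j]
        entire_mat_nth[OF assms(2), of i j]]) (simp add: assms(3))
  then show ?thesis by (simp add: vec_eq_iff)
qed

lemma entire_mat_eq_mult_inverse_imp_linear:
  assumes "entire_mat A" "entire_mat B" "A 0 = 0"
    and "\<And>t::real. t \<noteq> 0 \<Longrightarrow> A (of_real t) = cscale (of_real t) (B (inverse (of_real t)))"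
  shows "A z = cscale z (B 0)"
proof -
  have "A z $ i $ j = z * B 0 $ i $ j" for i j
    by (rule entire_eq_mult_inverse_imp_linear[OF entire_mat_nth[OF assms(1), of i j]
        entire_mat_nth[OF assms(2), of i j]]) (simp_all add: assms(3,4))
  then show ?thesis by (simp add: vec_eq_iff)
qed

section \<open>Families of entire matrix functions\<close>

text \<open>The derivative is asked for at \<open>s = 0\<close> only, since moving the base point
  covers the other values of \<open>s\<close>. Joint continuity away from \<open>z = 0\<close> is
  what makes the difference quotients converge uniformly on circles. Keeping the direction
  \<open>v\<close> free lets both coordinates share one argument.\<close>

definition partial_along ::
  "(real \<times> real) set \<Rightarrow> real \<times> real \<Rightarrow> (real \<times> real \<Rightarrow> complex \<Rightarrow> cmat2) \<Rightarrow>
   (real \<times> real \<Rightarrow> complex \<Rightarrow> cmat2) \<Rightarrow> bool" where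
  "partial_along D v H H' \<longleftrightarrow>
     (\<forall>p\<in>D. \<forall>z. z \<noteq> 0 \<longrightarrow> ((\<lambda>s. H (p + s *\<^sub>R v) z) has_vector_derivative H' p z) (at 0)) \<and>
     continuous_on (D \<times> -{0}) (\<lambda>(p, z). H' p z)"

text \<open>No regularity in the point is required at the parameter \<^term>\<open>0::complex\<close>, where a smooth
  loop map says nothing about the expansions of its values.\<close>

definition entire_family :: "(real \<times> real) set \<Rightarrow> (real \<times> real \<Rightarrow> complex \<Rightarrow> cmat2) \<Rightarrow> bool" where
  "entire_family D H \<longleftrightarrow>
     (\<forall>p\<in>D. entire_mat (H p) \<and> (\<forall>z. det (H p z) = 1)) \<and> (\<forall>v. \<exists>H'. partial_along D v H H')"

lemma has_vector_derivative_along_shift: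
  fixes p v :: "'a::real_vector" and F :: "'a \<Rightarrow> 'b::real_normed_vector"
  assumes "((\<lambda>s. F (p + c *\<^sub>R v + s *\<^sub>R v)) has_vector_derivative d) (at 0)"
  shows "((\<lambda>s. F (p + s *\<^sub>R v)) has_vector_derivative d) (at c)"
proof -
  have "((\<lambda>s. s - c) has_vector_derivative 1) (at c)"
    by (auto intro!: derivative_eq_intros)
  from vector_diff_chain_at[OF this, of "\<lambda>s. F (p + c *\<^sub>R v + s *\<^sub>R v)" d] assms
  show ?thesis by (simp add: o_def algebra_simps)
qed

text \<open>Openness of \<open>D\<close> leaves room for a short segment through \<open>p\<close> in
  direction \<open>v\<close>; there \<open>parameter_derivative_entire\<close> is applied to each
  matrix entry.\<close>

lemma entire_family_partial:
  assumes D: "open D" and H: "entire_family D H" and p: "p \<in> D"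
  obtains K where "entire_mat K"
    "\<And>z. z \<noteq> 0 \<Longrightarrow> ((\<lambda>s. H (p + s *\<^sub>R v) z) has_vector_derivative K z) (at 0)"
    "\<And>C. (\<And>q. q \<in> D \<Longrightarrow> H q 0 = C) \<Longrightarrow> K 0 = 0"
proof -
  obtain H' where H': "partial_along D v H H'"
    using H unfolding entire_family_def by blast
  have "open ((\<lambda>s. p + s *\<^sub>R v) -` D)"
    by (intro continuous_open_vimage D continuous_intros)
  moreover have "0 \<in> (\<lambda>s. p + s *\<^sub>R v) -` D"
    using p by simp
  ultimately obtain e where e: "e > 0" and eD: "ball 0 e \<subseteq> (\<lambda>s. p + s *\<^sub>R v) -` D"
    by (meson openE)
  have inD: "p + s *\<^sub>R v \<in> D" if "\<bar>s\<bar> < e" for s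
    using eD that by (auto simp: subset_iff)
  have ent: "\<exists>K. K holomorphic_on UNIV \<and> (\<forall>z. z \<noteq> 0 \<longrightarrow> K z = H' (p + 0 *\<^sub>R v) z $ i $ j) \<and>
    (\<forall>c. (\<forall>s. \<bar>s\<bar> < e \<longrightarrow> H (p + s *\<^sub>R v) 0 $ i $ j = c) \<longrightarrow> K 0 = 0)" for i j
  proof (rule parameter_derivative_entire[OF e,
      of "\<lambda>s z. H (p + s *\<^sub>R v) z $ i $ j" "\<lambda>s z. H' (p + s *\<^sub>R v) z $ i $ j"])
    show "(\<lambda>z. H (p + s *\<^sub>R v) z $ i $ j) holomorphic_on UNIV" if "\<bar>s\<bar> < e" for s
      using H inD[OF that] by (auto simp: entire_family_def entire_mat_def)
    show "((\<lambda>s. H (p + s *\<^sub>R v) z $ i $ j) has_vector_derivative H' (p + s *\<^sub>R v) z $ i $ j) (at s)"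
      if "\<bar>s\<bar> < e" "z \<noteq> 0" for s z
    proof -
      have "((\<lambda>s. H (p + s *\<^sub>R v) z) has_vector_derivative H' (p + s *\<^sub>R v) z) (at s)"
        using H' inD[OF that(1)] that(2)
        by - (rule has_vector_derivative_along_shift[where F = "\<lambda>q. H q z"],
           auto simp: partial_along_def)
      then show ?thesis
        by (simp add: bounded_linear.has_vector_derivative[OF bounded_linear_vec_nth])
    qed
    have "continuous_on ({-e<..<e} \<times> -{0}) ((\<lambda>(p, z). H' p z) \<circ> (\<lambda>(s, z). (p + s *\<^sub>R v, z)))"
    proof (rule continuous_on_compose)
      show "continuous_on ({-e<..<e} \<times> -{0::complex}) (\<lambda>(s, z). (p + s *\<^sub>R v, z))"
        by (auto simp: case_prod_unfold intro!: continuous_intros)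
      show "continuous_on ((\<lambda>(s, z). (p + s *\<^sub>R v, z)) ` ({-e<..<e} \<times> -{0})) (\<lambda>(p, z). H' p z)"
        by (rule continuous_on_subset[of "D \<times> -{0}"])
           (use H' inD in \<open>auto simp: partial_along_def\<close>)
    qed
    then show "continuous_on ({-e<..<e} \<times> -{0}) (\<lambda>(s, z). H' (p + s *\<^sub>R v) z $ i $ j)"
      by (auto simp: case_prod_unfold o_def intro!: continuous_intros)
  qed auto
  define K where "K i j = (SOME K. K holomorphic_on UNIV \<and> (\<forall>z. z \<noteq> 0 \<longrightarrow> K z = H' (p + 0 *\<^sub>R v) z $ i $ j) \<and>
    (\<forall>c. (\<forall>s. \<bar>s\<bar> < e \<longrightarrow> H (p + s *\<^sub>R v) 0 $ i $ j = c) \<longrightarrow> K 0 = 0))" for i j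
  have K: "K i j holomorphic_on UNIV" "\<And>z. z \<noteq> 0 \<Longrightarrow> K i j z = H' p z $ i $ j"
    "\<And>c. (\<And>s. \<bar>s\<bar> < e \<Longrightarrow> H (p + s *\<^sub>R v) 0 $ i $ j = c) \<Longrightarrow> K i j 0 = 0" for i j
    using someI_ex[OF ent[of i j], folded K_def] by auto
  show ?thesis
  proof
    show "entire_mat (\<lambda>z. \<chi> i j. K i j z)"
      using K(1) by (simp add: entire_mat_def)
    show "((\<lambda>s. H (p + s *\<^sub>R v) z) has_vector_derivative (\<chi> i j. K i j z)) (at 0)" if "z \<noteq> 0" for z
      using H' p that by (simp add: K(2) partial_along_def)
    show "(\<chi> i j. K i j 0) = (0 :: cmat2)" if "\<And>q. q \<in> D \<Longrightarrow> H q 0 = C" for C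
      using K(3)[of _ _ "C $ _ $ _"] that inD by (simp add: vec_eq_iff)
  qed
qed

lemma cmat2_mult_distribs:
  fixes A B C :: cmat2
  shows "A ** (B + C) = A ** B + A ** C" "(A + B) ** C = A ** C + B ** C"
    "A ** (B - C) = A ** B - A ** C" "(A - B) ** C = A ** C - B ** C"
    "A ** cscale c B = cscale c (A ** B)" "cscale c A ** B = cscale c (A ** B)"
    "cscale c (A + B) = cscale c A + cscale c B" "cscale c (A - B) = cscale c A - cscale c B"
    "cscale c (cscale d A) = cscale (c * d) A" "cscale 1 A = A"
  by (simp_all add: cmat2_eq_iff mult_nth2 algebra_simps)

text \<open>The derivative of the factorisation expresses \<open>X\<^sup>-\<^sup>1 X'\<close> through \<open>V\<close>. It vanishes at \<open>0\<close>
  because \<open>X\<close> is normalised there, and it grows at most linearly because \<open>V\<close> is bounded at infinity;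
  so only the coefficient of \<open>z\<close> survives.\<close>

lemma birkhoff_factor_derivative:
  fixes v :: "real \<times> real"
  assumes D: "open D" and X: "entire_family D X" and V: "entire_family D V" and p: "p \<in> D"
    and X0: "\<And>q. q \<in> D \<Longrightarrow> X q 0 = mat 1"
    and der: "\<And>t::real. t \<noteq> 0 \<Longrightarrow>
      ((\<lambda>s. X (p + s *\<^sub>R v) (of_real t) ** V (p + s *\<^sub>R v) (inverse (of_real t)))
        has_vector_derivative
        X p (of_real t) ** V p (inverse (of_real t)) **
          (cscale (of_real t) P + Q + cscale (inverse (of_real t)) R)) (at 0)"
    and t: "t \<noteq> 0"
  shows "((\<lambda>s. X (p + s *\<^sub>R v) (of_real t)) has_vector_derivative
    X p (of_real t) ** cscale (of_real t) (V p 0 ** P ** adj2 (V p 0))) (at 0)"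
proof -
  obtain X' where X': "entire_mat X'"
    "\<And>z. z \<noteq> 0 \<Longrightarrow> ((\<lambda>s. X (p + s *\<^sub>R v) z) has_vector_derivative X' z) (at 0)" "X' 0 = 0"
    using entire_family_partial[OF D X p] X0 by metis
  obtain V' where V': "entire_mat V'"
    "\<And>z. z \<noteq> 0 \<Longrightarrow> ((\<lambda>s. V (p + s *\<^sub>R v) z) has_vector_derivative V' z) (at 0)"
    using entire_family_partial[OF D V p] by metis
  have ent: "entire_mat (X p)" "entire_mat (V p)" and det: "det (X p z) = 1" "det (V p z) = 1" for z
    using X V p by (auto simp: entire_family_def)
  define M where "M z = adj2 (X p z) ** X' z" for z
  \<comment> \<open>The product rule gives \<open>M = V A V^-1 - V' V^-1\<close> with
    \<open>A = z P + Q + w R\<close> and \<open>w = 1/z\<close>. Pulling \<open>z\<close> out of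
    both terms leaves \<open>N w\<close>, which is entire in \<open>w\<close>; its value at 0 keeps
    only \<open>P\<close>.\<close>
  define N where "N w = V p w ** (P + cscale w Q + cscale (w ^ 2) R) ** adj2 (V p w)
    - cscale w (V' w ** adj2 (V p w))" for w
  have "M z = cscale z (N 0)" for z
  proof (rule entire_mat_eq_mult_inverse_imp_linear)
    show "entire_mat M" "entire_mat N"
      unfolding M_def N_def using ent X'(1) V'(1)
      by (auto intro!: holomorphic_intros entire_mat_mult entire_mat_add entire_mat_diff
          entire_mat_cscale entire_mat_adj2 entire_mat_const)
    show "M 0 = 0"
      by (simp add: M_def X'(3) cmat2_eq_iff mult_nth2)
    fix t :: real assume t: "t \<noteq> 0"
    define T where "T = complex_of_real t"
    define W where "W = inverse T"
    have TW: "T \<noteq> 0" "W \<noteq> 0" "T * W = 1"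
      using t by (auto simp: T_def W_def)
    define A where "A = cscale T P + Q + cscale W R"
    have "((\<lambda>s. X (p + s *\<^sub>R v) T ** V (p + s *\<^sub>R v) W) has_vector_derivative
        X p T ** V' W + X' T ** V p W) (at 0)"
      using bounded_bilinear.has_vector_derivative[OF bounded_bilinear_cmat2_mult
          X'(2)[OF TW(1)] V'(2)[OF TW(2)]] by simp
    moreover have "((\<lambda>s. X (p + s *\<^sub>R v) T ** V (p + s *\<^sub>R v) W) has_vector_derivative
        X p T ** V p W ** A) (at 0)"
      using der[OF t] by (simp add: T_def W_def A_def)
    ultimately have eq: "X p T ** V' W + X' T ** V p W = X p T ** V p W ** A"
      by (rule vector_derivative_unique_at)
    have "M T = adj2 (X p T) ** (X p T ** V' W + X' T ** V p W) ** adj2 (V p W) - V' W ** adj2 (V p W)"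
      using adj2_inverse[OF det(1)[of T]] adj2_inverse[OF det(2)[of W]]
      by (simp add: M_def cmat2_mult_distribs matrix_mul_assoc)
         (simp add: matrix_mul_assoc[symmetric])
    also have "\<dots> = V p W ** A ** adj2 (V p W) - V' W ** adj2 (V p W)"
      unfolding eq using adj2_inverse[OF det(1)[of T]] by (simp add: matrix_mul_assoc)
    also have "A = cscale T (P + cscale W Q + cscale (W ^ 2) R)"
      using TW(3) by (simp add: A_def cmat2_mult_distribs power2_eq_square mult.assoc[symmetric])
    also have "V' W ** adj2 (V p W) = cscale T (cscale W (V' W ** adj2 (V p W)))"
      using TW(3) by (simp add: cmat2_mult_distribs)
    finally show "M (of_real t) = cscale (of_real t) (N (inverse (of_real t)))"
      unfolding T_def[symmetric] W_def[symmetric] N_def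
      by (simp add: cmat2_mult_distribs mult_ac)
  qed
  moreover have "N 0 = V p 0 ** P ** adj2 (V p 0)"
    by (simp add: N_def cmat2_eq_iff mult_nth2)
  moreover have "X' z = X p z ** M z" for z
    using adj2_inverse[OF det(1)[of z]] by (simp add: M_def matrix_mul_assoc)
  ultimately show ?thesis
    using X'(2)[of "of_real t"] t by simp
qed

text \<open>Solving for \<open>V\<close> shows that \<open>adj2 (X z) ** W z\<close> is entire and
  equals an entire function of \<open>1/z\<close>, so both sides are constant; the constant is read
  off at 0, where \<open>X\<close> is the identity. It is used at the origin with \<open>W\<close>
  the identity, and on an axis, where one normalised factor is trivial.\<close>

lemma birkhoff_factor_const:
  assumes "entire_mat X" "entire_mat V" "entire_mat W" "X 0 = mat 1" "\<And>z. det (X z) = 1"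
    and eq: "\<And>t::real. t \<noteq> 0 \<Longrightarrow> X (of_real t) ** V (inverse (of_real t)) = W (of_real t)"
  shows "V z = W 0"
proof -
  have 1: "adj2 (X z) ** W z = V 0" for z
  proof (rule entire_mat_eq_inverse_imp_const[where A = "\<lambda>z. adj2 (X z) ** W z"])
    fix t :: real assume "t \<noteq> 0"
    from eq[OF this, symmetric] show "adj2 (X (of_real t)) ** W (of_real t) = V (inverse (of_real t))"
      by (simp add: matrix_mul_assoc adj2_inverse assms)
  qed (use assms in auto)
  have "V z = V 0"
  proof (rule entire_mat_eq_inverse_imp_const[where B = "\<lambda>_. V 0"])
    fix t :: real assume "t \<noteq> 0"
    then have "V (inverse (inverse (of_real t))) = adj2 (X (inverse (of_real t))) ** W (inverse (of_real t))"
      using eq[of "inverse t", symmetric] by (simp add: matrix_mul_assoc adj2_inverse assms)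
    then show "V (of_real t) = V 0" using 1 by simp
  qed (use assms in auto)
  moreover have "W 0 = V 0"
    using 1[of 0] by (simp add: assms)
  ultimately show ?thesis by simp
qed

section \<open>Power series of loops\<close>

text \<open>Convergence at every nonzero real point forces an infinite radius of
  convergence.\<close>

lemma power_series_entire_mat:
  fixes g :: "real \<Rightarrow> cmat2"
  assumes sums: "\<And>t. t \<noteq> 0 \<Longrightarrow> (\<lambda>n. t ^ n *\<^sub>R c n) sums g t"
  obtains M where "entire_mat M" "\<And>t. t \<noteq> 0 \<Longrightarrow> M (of_real t) = g t" "M 0 = c 0"
proof
  have entry: "(\<lambda>n. c n $ i $ j * of_real t ^ n) sums g t $ i $ j" if "t \<noteq> 0" for t i j
    using sums_vec_nth[OF sums_vec_nth[OF sums[OF that], of i], of j]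
    by (simp add: vector_scaleR_component scaleR_conv_of_real[where 'a = complex] mult.commute
        del: scaleR_conv_of_real)
  \<comment> \<open>The real point \<open>norm y + 1\<close> is nonzero and has larger modulus than
    \<open>y\<close>, so convergence there gives convergence at \<open>y\<close>.\<close>
  have summable: "summable (\<lambda>n. c n $ i $ j * y ^ n)" for i j and y :: complex
    by (rule powser_inside[of _ "of_real (norm y + 1)"])
       (use sums_summable[OF entry[of "norm y + 1" i j]] in \<open>auto simp: add_nonneg_eq_0_iff\<close>)
  show "entire_mat (\<lambda>z. \<chi> i j. \<Sum>n. c n $ i $ j * z ^ n)"
    using termdiffs_strong_converges_everywhere[OF summable]
    by (auto simp: entire_mat_def holomorphic_on_open)
  show "(\<chi> i j. \<Sum>n. c n $ i $ j * of_real t ^ n) = g t" if "t \<noteq> 0" for t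
    using sums_unique[OF entry[OF that]] by (simp add: vec_eq_iff)
  show "(\<chi> i j. \<Sum>n. c n $ i $ j * 0 ^ n) = c 0"
    by (simp add: vec_eq_iff powser_zero)
qed

text \<open>The map \<open>\<iota>\<close> will be the identity for plus loops and inversion for
  minus loops. The partial derivative of \<open>H\<close> is that of \<open>G\<close> in direction
  \<open>(v, 0)\<close>, evaluated at the moved parameter.\<close>

lemma partial_along_reparam:
  fixes G :: "real \<times> real \<Rightarrow> complex \<Rightarrow> cmat2" and \<iota> :: "complex \<Rightarrow> complex"
  assumes D: "open D" and smooth: "smooth_on (D \<times> -{0}) (\<lambda>(p, z). G p z)"
    and \<iota>: "continuous_on (-{0}) \<iota>" "\<And>z. z \<noteq> 0 \<Longrightarrow> \<iota> z \<noteq> 0"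
    and H: "\<And>p z. p \<in> D \<Longrightarrow> z \<noteq> 0 \<Longrightarrow> H p z = G p (\<iota> z)"
  shows "\<exists>H'. partial_along D v H H'"
proof -
  define g where "g = (\<lambda>(p, z). G p z)"
  have "Ck_on (Suc 0) (D \<times> -{0}) g"
    using smooth unfolding smooth_on_def g_def by blast
  then have diff: "g differentiable_on D \<times> -{0}"
    and cont: "\<And>u. continuous_on (D \<times> -{0}) (\<lambda>q. frechet_derivative g (at q) u)"
    by auto
  have op: "open (D \<times> -{0::complex})"
    using D by (intro open_Times) auto
  define H' where "H' p z = frechet_derivative g (at (p, \<iota> z)) (v, 0)" for p z
  have "((\<lambda>s. H (p + s *\<^sub>R v) z) has_vector_derivative H' p z) (at 0)" if "p \<in> D" "z \<noteq> 0" for p z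
  proof -
    have "(p, \<iota> z) \<in> D \<times> -{0}"
      using that \<iota> by auto
    then have "(g has_derivative frechet_derivative g (at (p, \<iota> z))) (at (p, \<iota> z))"
      using diff unfolding differentiable_on_eq_differentiable_at[OF op] frechet_derivative_works
      by blast
    moreover have "((\<lambda>s. (p + s *\<^sub>R v, \<iota> z)) has_vector_derivative (v, 0)) (at 0)"
      by (auto intro!: derivative_eq_intros has_vector_derivative_Pair)
    ultimately have "(g \<circ> (\<lambda>s. (p + s *\<^sub>R v, \<iota> z)) has_vector_derivative H' p z) (at 0)"
      unfolding H'_def by (intro vector_derivative_diff_chain_within) (auto intro: has_derivative_at_withinI)
    moreover have "open ((\<lambda>s. p + s *\<^sub>R v) -` D)"
      by (intro continuous_open_vimage D continuous_intros)
    ultimately show ?thesis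
      by (rule has_vector_derivative_transform_within_open) (use that in \<open>auto simp: g_def H\<close>)
  qed
  moreover have "continuous_on (D \<times> -{0}) ((\<lambda>q. frechet_derivative g (at q) (v, 0)) \<circ> (\<lambda>(p, z). (p, \<iota> z)))"
  proof (rule continuous_on_compose)
    show "continuous_on (D \<times> -{0}) (\<lambda>(p, z). (p, \<iota> z))"
      unfolding case_prod_unfold
      by (intro continuous_intros continuous_on_compose2[OF \<iota>(1)]) auto
    show "continuous_on ((\<lambda>(p, z). (p, \<iota> z)) ` (D \<times> -{0})) (\<lambda>q. frechet_derivative g (at q) (v, 0))"
      by (rule continuous_on_subset[OF cont]) (use \<iota>(2) in auto)
  qed
  ultimately show ?thesis
    unfolding partial_along_def by (intro exI[of _ H']) (auto simp: H'_def o_def case_prod_unfold)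
qed

lemma \<sigma>3_conj_nth2:
  "(\<sigma>3 ** A ** matrix_inv \<sigma>3) $ 1 $ 2 = - A $ 1 $ 2"
  "(\<sigma>3 ** A ** matrix_inv \<sigma>3) $ 2 $ 1 = - A $ 2 $ 1"
proof -
  have "matrix_inv \<sigma>3 = \<sigma>3"
    by (rule matrix_inv_eqI) (simp_all add: \<sigma>3_def cmat2_eq_iff mult_nth2)
  then show "(\<sigma>3 ** A ** matrix_inv \<sigma>3) $ 1 $ 2 = - A $ 1 $ 2"
    "(\<sigma>3 ** A ** matrix_inv \<sigma>3) $ 2 $ 1 = - A $ 2 $ 1"
    by (simp_all add: \<sigma>3_def mult_nth2)
qed

text \<open>Oddness extends from the nonzero reals to the whole plane, including 0. The twisting
  condition makes the off-diagonal entries odd, so the leading coefficients of the loops turn out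
  diagonal.\<close>

lemma entire_odd_imp_zero:
  assumes f: "f holomorphic_on UNIV" and odd: "\<And>t::real. t \<noteq> 0 \<Longrightarrow> f (- of_real t) = - f (of_real t)"
  shows "f (0::complex) = (0::complex)"
proof -
  have "f (- 0) = - f 0"
  proof (rule entire_eq_on_reals_imp_eq[where f = "\<lambda>z. f (- z)" and g = "\<lambda>z. - f z"])
    show "(\<lambda>z. f (- z)) holomorphic_on UNIV"
      by (rule holomorphic_on_compose_gen[OF _ f, unfolded o_def]) (auto intro!: holomorphic_intros)
    show "(\<lambda>z. - f z) holomorphic_on UNIV"
      by (intro holomorphic_intros f)
  qed (use odd in auto)
  then show ?thesis by simp
qed

text \<open>The power series supplies an entire function for each point, and the smooth extension
  \<open>G\<close> supplies regularity in the point. The identity theorem makes the two agree away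
  from 0, and it carries determinant 1 over from the real loops. The pair \<open>j\<close>,
  \<open>\<iota>\<close> is one reparametrisation on real and complex arguments, covering both kinds
  of expansion.\<close>

lemma loop_map_entire_family:
  assumes D: "open D" and smooth: "smooth_loop_map D F" and F: "\<And>p. p \<in> D \<Longrightarrow> F p \<in> Loop_SU2"
    and c: "\<And>p t. p \<in> D \<Longrightarrow> t \<noteq> 0 \<Longrightarrow> (\<lambda>n. t ^ n *\<^sub>R c p n) sums F p (j t)"
    and j: "\<And>t. t \<noteq> 0 \<Longrightarrow> j t \<noteq> 0" "\<And>t. j (- t) = - j t" "\<And>t. \<iota> (of_real t) = of_real (j t)"
    and \<iota>: "\<iota> holomorphic_on -{0}" "\<And>z. z \<noteq> 0 \<Longrightarrow> \<iota> z \<noteq> 0"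
  obtains H where "entire_family D H" "\<And>p t. p \<in> D \<Longrightarrow> t \<noteq> 0 \<Longrightarrow> H p (of_real t) = F p (j t)"
    "\<And>p. p \<in> D \<Longrightarrow> H p 0 = c p 0" "\<And>p. p \<in> D \<Longrightarrow> H p 0 $ 1 $ 2 = 0 \<and> H p 0 $ 2 $ 1 = 0"
proof -
  have "\<exists>M. entire_mat M \<and> (\<forall>t. t \<noteq> 0 \<longrightarrow> M (of_real t) = F p (j t)) \<and> M 0 = c p 0" if "p \<in> D" for p
    by (rule power_series_entire_mat[of "c p" "\<lambda>t. F p (j t)"]) (use c[OF that] in auto)
  then obtain H where H: "\<And>p. p \<in> D \<Longrightarrow> entire_mat (H p)"
    "\<And>p t. p \<in> D \<Longrightarrow> t \<noteq> 0 \<Longrightarrow> H p (of_real t) = F p (j t)" "\<And>p. p \<in> D \<Longrightarrow> H p 0 = c p 0"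
    by metis
  obtain G where G: "\<And>p. p \<in> D \<Longrightarrow> analytic_extension (F p) (G p)"
    and Gs: "smooth_on (D \<times> -{0}) (\<lambda>(p, z). G p z)"
    using smooth unfolding smooth_loop_map_def by blast
  have HG: "H p z = G p (\<iota> z)" if p: "p \<in> D" and z: "z \<noteq> 0" for p z
  proof -
    have "H p z $ k $ l = G p (\<iota> z) $ k $ l" for k l
    proof (rule holomorphic_punctured_eq_on_reals_imp_eq[where g = "\<lambda>z. G p (\<iota> z) $ k $ l", OF _ _ _ z])
      show "(\<lambda>z. H p z $ k $ l) holomorphic_on -{0}"
        by (rule holomorphic_on_subset[OF entire_mat_nth[OF H(1)[OF p]]]) auto
      have "(\<lambda>z. G p z $ k $ l) holomorphic_on -{0}"
        using G[OF p] by (auto simp: analytic_extension_def intro: analytic_imp_holomorphic)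
      then show "(\<lambda>z. G p (\<iota> z) $ k $ l) holomorphic_on -{0}"
        using \<iota>(2) by (intro holomorphic_on_compose_gen[OF \<iota>(1), unfolded o_def]) auto
      show "H p (of_real t) $ k $ l = G p (\<iota> (of_real t)) $ k $ l" if "t \<noteq> 0" for t
        using G[OF p] H(2)[OF p that] j that by (simp add: analytic_extension_def)
    qed
    then show ?thesis by (simp add: vec_eq_iff)
  qed
  have det: "det (H p z) = 1" if p: "p \<in> D" for p z
  proof (rule entire_eq_on_reals_imp_eq[where f = "\<lambda>z. det (H p z)" and g = "\<lambda>_. 1"])
    show "(\<lambda>z. det (H p z)) holomorphic_on UNIV"
      unfolding det_2 by (intro holomorphic_intros entire_mat_nth H p)
    show "det (H p (of_real t)) = 1" if "t \<noteq> 0" for t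
      using F[OF p] H(2)[OF p that] j(1)[OF that] by (simp add: Loop_SU2_def SU2_def)
  qed auto
  show ?thesis
  proof
    show "entire_family D H"
      unfolding entire_family_def
      using H(1) det partial_along_reparam[OF D Gs holomorphic_on_imp_continuous_on[OF \<iota>(1)] \<iota>(2) HG]
      by blast
    fix p assume p: "p \<in> D"
    show "H p (of_real t) = F p (j t)" if "t \<noteq> 0" for t
      using H(2)[OF p that] .
    show "H p 0 = c p 0"
      using H(3)[OF p] .
    have twist: "H p (- of_real t) = \<sigma>3 ** H p (of_real t) ** matrix_inv \<sigma>3" if "t \<noteq> 0" for t
      using F[OF p] H(2)[OF p that] H(2)[OF p, of "- t"] j(1)[OF that] j(2)[of t] that
      by (simp add: Loop_SU2_def)
    show "H p 0 $ 1 $ 2 = 0 \<and> H p 0 $ 2 $ 1 = 0"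
      using entire_odd_imp_zero[OF entire_mat_nth[OF H(1)[OF p], of 1 2]]
        entire_odd_imp_zero[OF entire_mat_nth[OF H(1)[OF p], of 2 1]]
      by (simp add: twist \<sigma>3_conj_nth2)
  qed
qed

text \<open>The predicate \<open>P\<close> transports a possible normalisation of the leading
  coefficient, so that factors with and without it are treated alike.\<close>

lemma plus_loop_map_entire_family:
  assumes "open D" "smooth_loop_map D F"
    and F: "\<And>p. p \<in> D \<Longrightarrow> F p \<in> Loop_SU2 \<and> (\<exists>c. plus_expansion (F p) c \<and> P (c 0))"
  shows "\<exists>H. entire_family D H \<and> (\<forall>p\<in>D. (\<forall>t. t \<noteq> 0 \<longrightarrow> H p (of_real t) = F p t) \<and>
    P (H p 0) \<and> H p 0 $ 1 $ 2 = 0 \<and> H p 0 $ 2 $ 1 = 0)"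
proof -
  obtain c where c: "\<And>p. p \<in> D \<Longrightarrow> plus_expansion (F p) (c p)" "\<And>p. p \<in> D \<Longrightarrow> P (c p 0)"
    using F by metis
  obtain H where "entire_family D H" "\<And>p t. p \<in> D \<Longrightarrow> t \<noteq> 0 \<Longrightarrow> H p (of_real t) = F p t"
    "\<And>p. p \<in> D \<Longrightarrow> H p 0 = c p 0" "\<And>p. p \<in> D \<Longrightarrow> H p 0 $ 1 $ 2 = 0 \<and> H p 0 $ 2 $ 1 = 0"
    by (rule loop_map_entire_family[OF assms(1,2), of c "\<lambda>t. t" "\<lambda>z. z"])
       (use F c in \<open>auto simp: plus_expansion_def\<close>)
  then show ?thesis
    using c(2) by (intro exI[of _ H]) auto
qed

lemma minus_loop_map_entire_family:
  assumes "open D" "smooth_loop_map D F"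
    and F: "\<And>p. p \<in> D \<Longrightarrow> F p \<in> Loop_SU2 \<and> (\<exists>c. minus_expansion (F p) c \<and> P (c 0))"
  shows "\<exists>H. entire_family D H \<and> (\<forall>p\<in>D. (\<forall>t. t \<noteq> 0 \<longrightarrow> H p (of_real t) = F p (inverse t)) \<and>
    P (H p 0) \<and> H p 0 $ 1 $ 2 = 0 \<and> H p 0 $ 2 $ 1 = 0)"
proof -
  obtain c where c: "\<And>p. p \<in> D \<Longrightarrow> minus_expansion (F p) (c p)" "\<And>p. p \<in> D \<Longrightarrow> P (c p 0)"
    using F by metis
  have sums: "(\<lambda>n. t ^ n *\<^sub>R c p n) sums F p (inverse t)" if "p \<in> D" "t \<noteq> 0" for p t
    using c(1)[OF that(1)] that(2)
    unfolding minus_expansion_def by (metis inverse_inverse_eq inverse_nonzero_iff_nonzero)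
  obtain H where "entire_family D H" "\<And>p t. p \<in> D \<Longrightarrow> t \<noteq> 0 \<Longrightarrow> H p (of_real t) = F p (inverse t)"
    "\<And>p. p \<in> D \<Longrightarrow> H p 0 = c p 0" "\<And>p. p \<in> D \<Longrightarrow> H p 0 $ 1 $ 2 = 0 \<and> H p 0 $ 2 $ 1 = 0"
    by (rule loop_map_entire_family[OF assms(1,2), of c inverse inverse])
       (use F c sums in \<open>auto intro!: holomorphic_intros\<close>)
  then show ?thesis
    using c(2) by (intro exI[of _ H]) auto
qed

section \<open>Derivatives of the Birkhoff factors\<close>

lemma eventually_along_in_open:
  fixes p u :: "'a::real_normed_vector"
  assumes "open D" "p \<in> D"
  shows "\<forall>\<^sub>F h in nhds (0::real). p + h *\<^sub>R u \<in> D"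
proof -
  have "open ((\<lambda>h. p + h *\<^sub>R u) -` D)"
    using assms(1) by (intro continuous_open_vimage continuous_intros)
  then show ?thesis
    using eventually_nhds_in_open[of "(\<lambda>h. p + h *\<^sub>R u) -` D" 0] assms(2) by simp
qed

lemma has_vector_derivative_transform_nhds:
  assumes "(f has_vector_derivative d) (at x)" "\<forall>\<^sub>F s in nhds x. g s = f s"
  shows "(g has_vector_derivative d) (at x)"
proof -
  obtain S where "open S" "x \<in> S" "\<And>s. s \<in> S \<Longrightarrow> g s = f s"
    using assms(2) unfolding eventually_nhds by blast
  then show ?thesis
    by (intro has_vector_derivative_transform_within_open[OF assms(1)]) auto
qed

lemma vector_derivative_shift_0:
  fixes f :: "real \<Rightarrow> 'a::real_normed_vector"
  shows "vector_derivative f (at c) = vector_derivative (\<lambda>s. f (c + s)) (at 0)"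
proof -
  have "(f has_vector_derivative d) (at c) \<longleftrightarrow> ((\<lambda>s. f (c + s)) has_vector_derivative d) (at 0)" for d
  proof
    assume "(f has_vector_derivative d) (at c)"
    moreover have "((\<lambda>s. c + s) has_vector_derivative 1) (at 0)"
      by (auto intro!: derivative_eq_intros)
    ultimately show "((\<lambda>s. f (c + s)) has_vector_derivative d) (at 0)"
      using vector_diff_chain_at[of "\<lambda>s. c + s" 1 0 f d] by (simp add: o_def)
  next
    assume "((\<lambda>s. f (c + s)) has_vector_derivative d) (at 0)"
    then show "(f has_vector_derivative d) (at c)"
      using has_vector_derivative_along_shift[of f 0 c 1 d] by simp
  qed
  then show ?thesis by (simp add: vector_derivative_def)
qed

lemma partial_x_along: "partial_x F p t = vector_derivative (\<lambda>s. F (p + s *\<^sub>R (1, 0)) t) (at 0)"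
  unfolding partial_x_def by (subst vector_derivative_shift_0) (cases p, simp)

lemma partial_y_along: "partial_y F p t = vector_derivative (\<lambda>s. F (p + s *\<^sub>R (0, 1)) t) (at 0)"
  unfolding partial_y_def by (subst vector_derivative_shift_0) (cases p, simp)

lemma const_along:
  fixes F :: "'a::real_normed_vector \<Rightarrow> 'b::real_normed_vector"
  assumes der: "\<And>q. q \<in> D \<Longrightarrow> ((\<lambda>s. F (q + s *\<^sub>R v)) has_vector_derivative 0) (at 0)"
    and seg: "closed_segment p (p + c *\<^sub>R v) \<subseteq> D"
  shows "F (p + c *\<^sub>R v) = F p"
proof -
  have "\<exists>d. \<forall>s\<in>closed_segment 0 c. F (p + s *\<^sub>R v) = d"
  proof (rule has_derivative_zero_constant)
    fix s assume "s \<in> closed_segment 0 c"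
    then obtain u where u: "0 \<le> u" "u \<le> 1" "s = u * c"
      by (auto simp: closed_segment_def)
    then have "p + s *\<^sub>R v \<in> closed_segment p (p + c *\<^sub>R v)"
      by (auto simp: closed_segment_def algebra_simps intro!: exI[of _ u])
    then have "((\<lambda>s. F (p + s *\<^sub>R v)) has_vector_derivative 0) (at s)"
      using seg by (intro has_vector_derivative_along_shift[of F p s v 0] der) auto
    then show "((\<lambda>s. F (p + s *\<^sub>R v)) has_derivative (\<lambda>h. 0)) (at s within closed_segment 0 c)"
      by (simp add: has_vector_derivative_def has_derivative_at_withinI)
  qed auto
  then show ?thesis
    by (metis add.right_neutral ends_in_segment scaleR_zero_left)
qed

text \<open>A compact segment in an open set has a tube around it inside the set, so the parallel
  segments through nearby points \<open>p + h *\<^sub>R u\<close> also stay in \<open>D\<close>.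
  Equality of germs in the direction \<open>u\<close> is needed because derivatives in that
  direction will be compared.\<close>

lemma eventually_const_along:
  fixes F :: "'a::euclidean_space \<Rightarrow> 'b::real_normed_vector"
  assumes D: "open D"
    and der: "\<And>q. q \<in> D \<Longrightarrow> ((\<lambda>s. F (q + s *\<^sub>R v)) has_vector_derivative 0) (at 0)"
    and seg: "closed_segment p (p + c *\<^sub>R v) \<subseteq> D"
  shows "\<forall>\<^sub>F h in nhds (0::real). F (p + h *\<^sub>R u + c *\<^sub>R v) = F (p + h *\<^sub>R u)"
proof -
  obtain e where e: "e > 0" "(\<Union>q\<in>closed_segment p (p + c *\<^sub>R v). ball q e) \<subseteq> D"
    using compact_subset_open_imp_ball_epsilon_subset[OF compact_segment D seg] by metis
  have "\<forall>\<^sub>F h in nhds (0::real). 0 + h *\<^sub>R u \<in> ball 0 e"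
    using e(1) by (intro eventually_along_in_open) auto
  then show ?thesis
  proof eventually_elim
    fix h assume h: "0 + h *\<^sub>R u \<in> ball 0 e"
    have "closed_segment (p + h *\<^sub>R u) (p + h *\<^sub>R u + c *\<^sub>R v) \<subseteq> D"
    proof
      fix q assume "q \<in> closed_segment (p + h *\<^sub>R u) (p + h *\<^sub>R u + c *\<^sub>R v)"
      then have "h *\<^sub>R u + (q - h *\<^sub>R u) \<in> closed_segment (h *\<^sub>R u + p) (h *\<^sub>R u + (p + c *\<^sub>R v))"
        by (simp add: algebra_simps)
      then have "q - h *\<^sub>R u \<in> closed_segment p (p + c *\<^sub>R v)"
        unfolding closed_segment_translation_eq .
      moreover have "q \<in> ball (q - h *\<^sub>R u) e"
        using h by (simp add: dist_norm)
      ultimately show "q \<in> D" using e(2) by blast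
    qed
    then show "F (p + h *\<^sub>R u + c *\<^sub>R v) = F (p + h *\<^sub>R u)"
      by (intro const_along der)
  qed
qed

text \<open>A value of \<open>vector_derivative\<close> alone does not guarantee differentiability
  of \<open>U\<close>. The product rule for the two entire families provides it, and uniqueness of
  derivatives then turns the equation for \<open>U\<close> into the hypothesis of
  \<open>birkhoff_factor_derivative\<close>.\<close>

lemma loop_factor_derivative:
  fixes v :: "real \<times> real"
  assumes D: "open D" and X: "entire_family D X" and V: "entire_family D V" and p: "p \<in> D"
    and X0: "\<And>q. q \<in> D \<Longrightarrow> X q 0 = mat 1"
    and U: "\<And>q t. q \<in> D \<Longrightarrow> t \<noteq> 0 \<Longrightarrow> U q t = X q (of_real t) ** V q (inverse (of_real t))"
    and F: "\<And>q t. q \<in> D \<Longrightarrow> t \<noteq> 0 \<Longrightarrow> F q t = X q (of_real t)"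
    and der: "\<And>t. t \<noteq> 0 \<Longrightarrow> vector_derivative (\<lambda>s. U (p + s *\<^sub>R v) t) (at 0) =
      U p t ** (cscale (of_real t) P + Q + cscale (inverse (of_real t)) R)"
    and t: "t \<noteq> 0"
  shows "((\<lambda>s. F (p + s *\<^sub>R v) t) has_vector_derivative
    F p t ** cscale (of_real t) (V p 0 ** P ** adj2 (V p 0))) (at 0)"
proof -
  note ev = eventually_along_in_open[OF D p, of v]
  have XV: "((\<lambda>s. X (p + s *\<^sub>R v) (of_real t) ** V (p + s *\<^sub>R v) (inverse (of_real t)))
      has_vector_derivative
      X p (of_real t) ** V p (inverse (of_real t)) **
        (cscale (of_real t) P + Q + cscale (inverse (of_real t)) R)) (at 0)"
    (is "(?XV has_vector_derivative _) _") if t: "t \<noteq> 0" for t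
  proof -
    obtain X' where X': "\<And>z. z \<noteq> 0 \<Longrightarrow> ((\<lambda>s. X (p + s *\<^sub>R v) z) has_vector_derivative X' z) (at 0)"
      using entire_family_partial[OF D X p] by metis
    obtain V' where V': "\<And>z. z \<noteq> 0 \<Longrightarrow> ((\<lambda>s. V (p + s *\<^sub>R v) z) has_vector_derivative V' z) (at 0)"
      using entire_family_partial[OF D V p] by metis
    obtain d where d: "(?XV has_vector_derivative d) (at 0)"
      using bounded_bilinear.has_vector_derivative[OF bounded_bilinear_cmat2_mult
          X'[of "of_real t"] V'[of "inverse (of_real t)"]] t by auto
    have "((\<lambda>s. U (p + s *\<^sub>R v) t) has_vector_derivative d) (at 0)"
      by (rule has_vector_derivative_transform_nhds[OF d])
         (rule eventually_mono[OF ev], simp add: U t)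
    from vector_derivative_at[OF this] der[OF t] d show ?thesis
      by (simp add: U[OF p t])
  qed
  have "((\<lambda>s. X (p + s *\<^sub>R v) (of_real t)) has_vector_derivative
      X p (of_real t) ** cscale (of_real t) (V p 0 ** P ** adj2 (V p 0))) (at 0)"
    by (rule birkhoff_factor_derivative[OF D X V p X0 XV t])
  then show ?thesis
    unfolding F[OF p t]
    by (rule has_vector_derivative_transform_nhds) (rule eventually_mono[OF ev], simp add: F t)
qed

text \<open>For diagonal \<open>A\<close> the adjugate swaps the diagonal entries, so each of them
  meets itself and appears squared. Hence only the squares of the leading coefficients have to be
  found.\<close>

lemma diagonal_conj_antidiagonal:
  assumes "A $ 1 $ 2 = 0 \<and> A $ 2 $ 1 = 0"
  shows "A ** mat2 0 b c 0 ** adj2 A = mat2 0 (A $ 1 $ 1 ^ 2 * b) (A $ 2 $ 2 ^ 2 * c) 0"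
  using assms by (simp add: cmat2_eq_iff mult_nth2 adj2_def power2_eq_square)

theorem mainTheorem4:
  fixes D :: "(real \<times> real) set"
    and \<phi> :: "real \<times> real \<Rightarrow> real"
    and U UX Vminus UY Vplus :: "real \<times> real \<Rightarrow> loop"
  assumes "open D" and "connected D" and "(0, 0) \<in> D"
    and "smooth_on D \<phi>"
    and "\<And>p. p \<in> D \<Longrightarrow> U p \<in> Loop_SU2" and "smooth_loop_map D U"
    and "\<And>x y t. (x, y) \<in> D \<Longrightarrow> t \<noteq> 0 \<Longrightarrow>
           partial_x U (x, y) t =
             cscale (\<i> / 2) (U (x, y) t **
               mat2 (- of_real (deriv (\<lambda>s. \<phi> (s, y)) x)) (of_real t)
                    (of_real t) (of_real (deriv (\<lambda>s. \<phi> (s, y)) x)))"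
    and "\<And>x y t. (x, y) \<in> D \<Longrightarrow> t \<noteq> 0 \<Longrightarrow>
           partial_y U (x, y) t =
             cscale (- (\<i> / (2 * of_real t))) (U (x, y) t **
               mat2 0 (exp (\<i> * of_real (\<phi> (x, y))))
                    (exp (- (\<i> * of_real (\<phi> (x, y))))) 0)"
    and "\<And>t. t \<noteq> 0 \<Longrightarrow> U (0, 0) t = mat 1"
    and "\<And>p. p \<in> D \<Longrightarrow> UX p \<in> Loop_plus_normalized" and "smooth_loop_map D UX"
    and "\<And>p. p \<in> D \<Longrightarrow> Vminus p \<in> Loop_minus" and "smooth_loop_map D Vminus"
    and "\<And>p. p \<in> D \<Longrightarrow> UY p \<in> Loop_minus_normalized" and "smooth_loop_map D UY"
    and "\<And>p. p \<in> D \<Longrightarrow> Vplus p \<in> Loop_plus" and "smooth_loop_map D Vplus"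
    and "\<And>p t. p \<in> D \<Longrightarrow> t \<noteq> 0 \<Longrightarrow> U p t = UX p t ** Vminus p t"
    and "\<And>p t. p \<in> D \<Longrightarrow> t \<noteq> 0 \<Longrightarrow> U p t = UY p t ** Vplus p t"
  shows "(\<forall>x y y'. closed_segment (x, y) (x, y') \<subseteq> D \<longrightarrow>
             indep_of_y (closed_segment (x, y) (x, y')) UX) \<and>
         (\<forall>x x' y. closed_segment (x, y) (x', y) \<subseteq> D \<longrightarrow>
             indep_of_x (closed_segment (x, y) (x', y)) UY) \<and>
         (\<forall>x y t. over_x_axis D UX UY x y \<longrightarrow> t \<noteq> 0 \<longrightarrow>
             (let \<alpha> = \<phi> (x, 0) - \<phi> (0, 0) in
               matrix_inv (UX (x, y) t) ** partial_x UX (x, y) t =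
                 cscale (\<i> / 2 * of_real t)
                   (mat2 0 (exp (- (\<i> * of_real \<alpha>)))
                         (exp (\<i> * of_real \<alpha>)) 0))) \<and>
         (\<forall>x y t. over_y_axis D UX UY x y \<longrightarrow> t \<noteq> 0 \<longrightarrow>
             (let \<beta> = \<phi> (0, y) in
               matrix_inv (UY (x, y) t) ** partial_y UY (x, y) t =
                 cscale (- (\<i> / (2 * of_real t)))
                   (mat2 0 (exp (\<i> * of_real \<beta>))
                         (exp (- (\<i> * of_real \<beta>))) 0)))"
proof -
  note D = assms(1) and O = assms(3)
  note U_x = assms(7) and U_y = assms(8) and U_0 = assms(9)
  define e1 e2 :: "real \<times> real" where "e1 = (1, 0)" and "e2 = (0, 1)"

  \<comment> \<open>Entire families for the four Birkhoff factors\<close>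
  have "\<exists>H. entire_family D H \<and> (\<forall>p\<in>D. (\<forall>t. t \<noteq> 0 \<longrightarrow> H p (of_real t) = UX p t) \<and>
      H p 0 = mat 1 \<and> H p 0 $ 1 $ 2 = 0 \<and> H p 0 $ 2 $ 1 = 0)"
    by (rule plus_loop_map_entire_family[OF D assms(11), of "\<lambda>c. c = mat 1"])
       (use assms(10) in \<open>auto simp: Loop_plus_normalized_def\<close>)
  then obtain X where X: "entire_family D X" "\<And>p t. p \<in> D \<Longrightarrow> t \<noteq> 0 \<Longrightarrow> X p (of_real t) = UX p t"
    "\<And>p. p \<in> D \<Longrightarrow> X p 0 = mat 1"
    by blast
  have "\<exists>H. entire_family D H \<and> (\<forall>p\<in>D. (\<forall>t. t \<noteq> 0 \<longrightarrow> H p (of_real t) = Vminus p (inverse t)) \<and>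
      True \<and> H p 0 $ 1 $ 2 = 0 \<and> H p 0 $ 2 $ 1 = 0)"
    by (rule minus_loop_map_entire_family[OF D assms(13), of "\<lambda>c. True"])
       (use assms(12) in \<open>auto simp: Loop_minus_def\<close>)
  then obtain V where V: "entire_family D V"
    "\<And>p t. p \<in> D \<Longrightarrow> t \<noteq> 0 \<Longrightarrow> V p (of_real t) = Vminus p (inverse t)"
    "\<And>p. p \<in> D \<Longrightarrow> V p 0 $ 1 $ 2 = 0 \<and> V p 0 $ 2 $ 1 = 0"
    by blast
  have "\<exists>H. entire_family D H \<and> (\<forall>p\<in>D. (\<forall>t. t \<noteq> 0 \<longrightarrow> H p (of_real t) = UY p (inverse t)) \<and>
      H p 0 = mat 1 \<and> H p 0 $ 1 $ 2 = 0 \<and> H p 0 $ 2 $ 1 = 0)"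
    by (rule minus_loop_map_entire_family[OF D assms(15), of "\<lambda>c. c = mat 1"])
       (use assms(14) in \<open>auto simp: Loop_minus_normalized_def\<close>)
  then obtain Y where Y: "entire_family D Y"
    "\<And>p t. p \<in> D \<Longrightarrow> t \<noteq> 0 \<Longrightarrow> Y p (of_real t) = UY p (inverse t)"
    "\<And>p. p \<in> D \<Longrightarrow> Y p 0 = mat 1"
    by blast
  have "\<exists>H. entire_family D H \<and> (\<forall>p\<in>D. (\<forall>t. t \<noteq> 0 \<longrightarrow> H p (of_real t) = Vplus p t) \<and>
      True \<and> H p 0 $ 1 $ 2 = 0 \<and> H p 0 $ 2 $ 1 = 0)"
    by (rule plus_loop_map_entire_family[OF D assms(17), of "\<lambda>c. True"])
       (use assms(16) in \<open>auto simp: Loop_plus_def\<close>)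
  then obtain W where W: "entire_family D W" "\<And>p t. p \<in> D \<Longrightarrow> t \<noteq> 0 \<Longrightarrow> W p (of_real t) = Vplus p t"
    "\<And>p. p \<in> D \<Longrightarrow> W p 0 $ 1 $ 2 = 0 \<and> W p 0 $ 2 $ 1 = 0"
    by blast
  have ent: "entire_mat (X p)" "entire_mat (V p)" "entire_mat (Y p)" "entire_mat (W p)"
    and det: "det (X p z) = 1" "det (V p z) = 1" "det (Y p z) = 1" "det (W p z) = 1"
    if "p \<in> D" for p z
    using X(1) V(1) Y(1) W(1) that by (auto simp: entire_family_def)
  have UXV: "U p t = X p (of_real t) ** V p (inverse (of_real t))" if "p \<in> D" "t \<noteq> 0" for p t
    using X(2)[OF that] V(2)[OF that(1), of "inverse t"] assms(18)[OF that] that(2)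
    by (simp add: of_real_inverse)
  \<comment> \<open>Evaluating \<open>U\<close> at the reciprocal parameter exchanges plus and
    minus, so the second factorisation takes the shape of the first and the same lemmas
    apply.\<close>
  have UYW: "U p (inverse t) = Y p (of_real t) ** W p (inverse (of_real t))" if "p \<in> D" "t \<noteq> 0" for p t
    using Y(2)[OF that] W(2)[OF that(1), of "inverse t"] assms(19)[OF that(1), of "inverse t"] that(2)
    by (simp add: of_real_inverse)
  have detUX: "det (UX p t) = 1" and detUY: "det (UY p t) = 1" if "p \<in> D" "t \<noteq> 0" for p t
    using det(1)[OF that(1), of "of_real t"] X(2)[OF that]
      det(3)[OF that(1), of "of_real (inverse t)"] Y(2)[OF that(1), of "inverse t"] that(2)
    by auto

  \<comment> \<open>Coefficients of the two potentials in the spectral parameter\<close>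
  define P where "P = mat2 0 (\<i> / 2) (\<i> / 2) 0"
  define Q where "Q p = mat2 (- (\<i> / 2) * of_real (deriv (\<lambda>s. \<phi> (s, snd p)) (fst p))) 0 0
    (\<i> / 2 * of_real (deriv (\<lambda>s. \<phi> (s, snd p)) (fst p)))" for p
  define B where "B p = mat2 0 (- (\<i> / 2) * exp (\<i> * of_real (\<phi> p)))
    (- (\<i> / 2) * exp (- (\<i> * of_real (\<phi> p)))) 0" for p
  have dUx: "vector_derivative (\<lambda>s. U (p + s *\<^sub>R e1) t) (at 0) = U p t ** (cscale (of_real t) P + Q p)"
    if "p \<in> D" "t \<noteq> 0" for p t
    using U_x[of "fst p" "snd p" t] that
    by (simp add: partial_x_along e1_def P_def Q_def cmat2_eq_iff mult_nth2 algebra_simps)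
  have dUy: "vector_derivative (\<lambda>s. U (p + s *\<^sub>R e2) t) (at 0) = U p t ** cscale (inverse (of_real t)) (B p)"
    if "p \<in> D" "t \<noteq> 0" for p t
    using U_y[of "fst p" "snd p" t] that
    by (simp add: partial_y_along e2_def B_def cmat2_eq_iff mult_nth2 field_simps)

  \<comment> \<open>Derivatives of the normalised factors\<close>
  have cs0: "cscale c 0 = 0" "A ** 0 = (0 :: cmat2)" "0 ** A = (0 :: cmat2)" for c A
    by (simp_all add: cmat2_eq_iff mult_nth2)
  have X_x: "((\<lambda>s. UX (p + s *\<^sub>R e1) t) has_vector_derivative
      UX p t ** cscale (of_real t) (V p 0 ** P ** adj2 (V p 0))) (at 0)"
    if p: "p \<in> D" and t: "t \<noteq> 0" for p t
    by (rule loop_factor_derivative[OF D X(1) V(1) p X(3) UXV _ _ t, where Q = "Q p" and R = 0])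
       (use dUx p X(2) in \<open>auto simp: cs0\<close>)
  \<comment> \<open>The \<open>y\<close>-potential is \<open>B p\<close> divided by the parameter;
    it has no linear term, so the coefficient that would survive is 0.\<close>
  have X_y: "((\<lambda>s. UX (p + s *\<^sub>R e2) t) has_vector_derivative 0) (at 0)"
    if p: "p \<in> D" and t: "t \<noteq> 0" for p t
  proof -
    have "((\<lambda>s. UX (p + s *\<^sub>R e2) t) has_vector_derivative
      UX p t ** cscale (of_real t) (V p 0 ** 0 ** adj2 (V p 0))) (at 0)"
      by (rule loop_factor_derivative[OF D X(1) V(1) p X(3) UXV _ _ t, where Q = 0 and R = "B p"])
         (use dUy p X(2) in \<open>auto simp: cs0\<close>)
    then show ?thesis by (simp add: cs0)
  qed
  have Y_y': "((\<lambda>s. UY (p + s *\<^sub>R e2) (inverse t)) has_vector_derivative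
      UY p (inverse t) ** cscale (of_real t) (W p 0 ** B p ** adj2 (W p 0))) (at 0)"
    if p: "p \<in> D" and t: "t \<noteq> 0" for p t
    by (rule loop_factor_derivative[OF D Y(1) W(1) p Y(3) UYW _ _ t, where Q = 0 and R = 0])
       (use dUy[OF p, of "inverse _"] p Y(2) in \<open>auto simp: cs0\<close>)
  have Y_y: "((\<lambda>s. UY (p + s *\<^sub>R e2) t) has_vector_derivative
      UY p t ** cscale (inverse (of_real t)) (W p 0 ** B p ** adj2 (W p 0))) (at 0)"
    if "p \<in> D" "t \<noteq> 0" for p t
    using Y_y'[OF that(1), of "inverse t"] that(2) by (simp add: of_real_inverse)
  \<comment> \<open>In the reciprocal parameter the \<open>x\<close>-potential has
    \<open>Q p\<close> as constant term and \<open>P\<close> as coefficient of the inverse power;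
    again there is no linear term.\<close>
  have Y_x: "((\<lambda>s. UY (p + s *\<^sub>R e1) t) has_vector_derivative 0) (at 0)"
    if p: "p \<in> D" and t: "t \<noteq> 0" for p t
  proof -
    have t': "inverse t \<noteq> 0" using t by simp
    have "((\<lambda>s. UY (p + s *\<^sub>R e1) (inverse (inverse t))) has_vector_derivative
      UY p (inverse (inverse t)) ** cscale (of_real (inverse t)) (W p 0 ** 0 ** adj2 (W p 0))) (at 0)"
      by (rule loop_factor_derivative[OF D Y(1) W(1) p Y(3) UYW _ _ t', where Q = "Q p" and R = P])
         (use dUx[OF p, of "inverse _"] p Y(2) in \<open>auto simp: cs0 add.commute\<close>)
    then show ?thesis by (simp add: cs0)
  qed

  \<comment> \<open>Factors at the origin and where one of them is trivial\<close>
  have W_0: "W (0, 0) z = mat 1" for z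
    by (rule birkhoff_factor_const[where X = "Y (0, 0)" and W = "\<lambda>_. mat 1"])
       (use UYW[OF O] U_0 in \<open>auto simp: ent det O Y(3)\<close>)
  have V_0: "V (0, 0) z = mat 1" for z
    by (rule birkhoff_factor_const[where X = "X (0, 0)" and W = "\<lambda>_. mat 1"])
       (use UXV[OF O] U_0 in \<open>auto simp: ent det O X(3)\<close>)
  have UX_0: "UX (0, 0) t = mat 1" if "t \<noteq> 0" for t
    using UXV[OF O that] X(2)[OF O that] U_0[OF that] by (simp add: V_0)
  have UY_0: "UY (0, 0) t = mat 1" if "t \<noteq> 0" for t
    using UYW[OF O, of "inverse t"] Y(2)[OF O, of "inverse t"] U_0[OF that] that by (simp add: W_0)

  have V_eq_W_x: "V p 0 = W p 0" if p: "p \<in> D" and 1: "\<And>t. t \<noteq> 0 \<Longrightarrow> UY p t = mat 1" for p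
  proof (rule birkhoff_factor_const[where X = "X p" and V = "V p"])
    fix t :: real assume t: "t \<noteq> 0"
    show "X p (of_real t) ** V p (inverse (of_real t)) = W p (of_real t)"
      using UXV[OF p t] assms(19)[OF p t] 1[OF t] W(2)[OF p t] by simp
  qed (use p in \<open>auto simp: ent det X(3)\<close>)
  have W_eq_V_y: "W p 0 = V p 0" if p: "p \<in> D" and 1: "\<And>t. t \<noteq> 0 \<Longrightarrow> UX p t = mat 1" for p
  proof (rule birkhoff_factor_const[where X = "Y p" and V = "W p"])
    fix t :: real assume t: "t \<noteq> 0"
    show "Y p (of_real t) ** W p (inverse (of_real t)) = V p (of_real t)"
      using UYW[OF p t] assms(18)[OF p, of "inverse t"] 1[of "inverse t"] V(2)[OF p t] t by simp
  qed (use p in \<open>auto simp: ent det Y(3)\<close>)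

  \<comment> \<open>Comparison of germs over the axes\<close>
  have indep_yD: "F (x, y) t = F (x, y') t"
    if "indep_of_y D F" "t \<noteq> 0" "(x, y) \<in> D" "(x, y') \<in> D" for F x y y' t
    using that unfolding indep_of_y_def by blast
  have indep_xD: "F (x, y) t = F (x', y) t"
    if "indep_of_x D F" "t \<noteq> 0" "(x, y) \<in> D" "(x', y) \<in> D" for F x x' y t
    using that unfolding indep_of_x_def by blast
  \<comment> \<open>The first germ equality moves the \<open>x\<close>-derivative of
    \<open>UX\<close> from \<open>(x, 0)\<close> to \<open>(x, y)\<close>; the second moves the
    \<open>y\<close>-derivative of \<open>UY\<close> from the origin to \<open>(x, 0)\<close>.
    Segments give them by a tube argument, global independence gives them directly.\<close>
  have local_x: "(x, 0) \<in> D \<and> (x, y) \<in> D \<and>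
      (\<forall>\<^sub>F h in nhds 0. UX ((x, y) + h *\<^sub>R e1) t = UX ((x, 0) + h *\<^sub>R e1) t) \<and>
      (\<forall>\<^sub>F h in nhds 0. UY ((x, 0) + h *\<^sub>R e2) t = UY ((0, 0) + h *\<^sub>R e2) t)"
    if "over_x_axis D UX UY x y" "t \<noteq> 0" for x y t
    using that(1) unfolding over_x_axis_def
  proof (elim disjE conjE)
    assume seg: "closed_segment (0, 0) (x, 0) \<subseteq> D" "closed_segment (x, 0) (x, y) \<subseteq> D"
    have "\<forall>\<^sub>F h in nhds 0. UX ((x, 0) + h *\<^sub>R e1 + y *\<^sub>R e2) t = UX ((x, 0) + h *\<^sub>R e1) t"
      using seg(2) that(2) X_y
      by (intro eventually_const_along[OF D, of "\<lambda>q. UX q t"]) (auto simp: e2_def)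
    moreover have "\<forall>\<^sub>F h in nhds 0. UY ((0, 0) + h *\<^sub>R e2 + x *\<^sub>R e1) t = UY ((0, 0) + h *\<^sub>R e2) t"
      using seg(1) that(2) Y_x
      by (intro eventually_const_along[OF D, of "\<lambda>q. UY q t"]) (auto simp: e1_def)
    ultimately show ?thesis
      using seg by (auto simp: e1_def e2_def)
  next
    assume in_D: "(x, 0) \<in> D" "(x, y) \<in> D" and ind: "indep_of_y D UX" "indep_of_x D UY"
    have "\<forall>\<^sub>F h in nhds 0. UX ((x, y) + h *\<^sub>R e1) t = UX ((x, 0) + h *\<^sub>R e1) t"
      using eventually_along_in_open[OF D in_D(1), of e1] eventually_along_in_open[OF D in_D(2), of e1]
      by eventually_elim (auto simp: e1_def intro: indep_yD[OF ind(1) that(2)])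
    moreover have "\<forall>\<^sub>F h in nhds 0. UY ((x, 0) + h *\<^sub>R e2) t = UY ((0, 0) + h *\<^sub>R e2) t"
      using eventually_along_in_open[OF D in_D(1), of e2] eventually_along_in_open[OF D O, of e2]
      by eventually_elim (auto simp: e2_def intro: indep_xD[OF ind(2) that(2)])
    ultimately show ?thesis using in_D by blast
  qed
  have local_y: "(0, y) \<in> D \<and> (x, y) \<in> D \<and>
      (\<forall>\<^sub>F h in nhds 0. UY ((x, y) + h *\<^sub>R e2) t = UY ((0, y) + h *\<^sub>R e2) t) \<and>
      (\<forall>\<^sub>F h in nhds 0. UX ((0, y) + h *\<^sub>R e1) t = UX ((0, 0) + h *\<^sub>R e1) t)"
    if "over_y_axis D UX UY x y" "t \<noteq> 0" for x y t
    using that(1) unfolding over_y_axis_def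
  proof (elim disjE conjE)
    assume seg: "closed_segment (0, 0) (0, y) \<subseteq> D" "closed_segment (0, y) (x, y) \<subseteq> D"
    have "\<forall>\<^sub>F h in nhds 0. UY ((0, y) + h *\<^sub>R e2 + x *\<^sub>R e1) t = UY ((0, y) + h *\<^sub>R e2) t"
      using seg(2) that(2) Y_x
      by (intro eventually_const_along[OF D, of "\<lambda>q. UY q t"]) (auto simp: e1_def)
    moreover have "\<forall>\<^sub>F h in nhds 0. UX ((0, 0) + h *\<^sub>R e1 + y *\<^sub>R e2) t = UX ((0, 0) + h *\<^sub>R e1) t"
      using seg(1) that(2) X_y
      by (intro eventually_const_along[OF D, of "\<lambda>q. UX q t"]) (auto simp: e2_def)
    ultimately show ?thesis
      using seg by (auto simp: e1_def e2_def)
  next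
    assume in_D: "(0, y) \<in> D" "(x, y) \<in> D" and ind: "indep_of_y D UX" "indep_of_x D UY"
    have "\<forall>\<^sub>F h in nhds 0. UY ((x, y) + h *\<^sub>R e2) t = UY ((0, y) + h *\<^sub>R e2) t"
      using eventually_along_in_open[OF D in_D(1), of e2] eventually_along_in_open[OF D in_D(2), of e2]
      by eventually_elim (auto simp: e2_def intro: indep_xD[OF ind(2) that(2)])
    moreover have "\<forall>\<^sub>F h in nhds 0. UX ((0, y) + h *\<^sub>R e1) t = UX ((0, 0) + h *\<^sub>R e1) t"
      using eventually_along_in_open[OF D in_D(1), of e1] eventually_along_in_open[OF D O, of e1]
      by eventually_elim (auto simp: e1_def intro: indep_yD[OF ind(1) that(2)])
    ultimately show ?thesis using in_D by blast
  qed

  have inv_mult: "matrix_inv A ** (A ** M) = M" if "det A = 1" for A M :: cmat2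
    using matrix_inv_eqI[OF adj2_inverse[OF that]] adj2_inverse[OF that] by (simp add: matrix_mul_assoc)

  \<comment> \<open>The angle over the x-axis\<close>
  have eq_x: "matrix_inv (UX (x, y) t) ** partial_x UX (x, y) t =
      cscale (\<i> / 2 * of_real t)
        (mat2 0 (exp (- (\<i> * of_real (\<phi> (x, 0) - \<phi> (0, 0)))))
              (exp (\<i> * of_real (\<phi> (x, 0) - \<phi> (0, 0)))) 0)"
    if over: "over_x_axis D UX UY x y" and t: "t \<noteq> 0" for x y t
  proof -
    have p: "(x, 0) \<in> D" and q: "(x, y) \<in> D"
      and evX: "\<forall>\<^sub>F h in nhds 0. UX ((x, y) + h *\<^sub>R e1) t = UX ((x, 0) + h *\<^sub>R e1) t"
      and evY: "\<forall>\<^sub>F h in nhds 0. UY ((x, 0) + h *\<^sub>R e2) t = UY ((0, 0) + h *\<^sub>R e2) t"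
      using local_x[OF that] by auto
    \<comment> \<open>The case \<open>h = 0\<close> of the germ equality, for every nonzero
      parameter.\<close>
    have UY1: "UY (x, 0) s = mat 1" if "s \<noteq> 0" for s
      using local_x[OF over that] UY_0[OF that] by (auto dest: eventually_nhds_x_imp_x)
    define A where "A = W (x, 0) 0"
    have AV: "V (x, 0) 0 = A" and A_diag: "A $ 1 $ 2 = 0 \<and> A $ 2 $ 1 = 0"
      using V_eq_W_x[OF p UY1] W(3)[OF p] by (auto simp: A_def)
    \<comment> \<open>The same \<open>y\<close>-derivative is computed twice: transported from the
      origin it gives \<open>B (0, 0)\<close>, and by \<open>Y_y\<close> at \<open>(x, 0)\<close> it
      gives the conjugate of \<open>B (x, 0)\<close> by \<open>A\<close>. The quotient of the two
      exponentials is the square of a diagonal entry, which is where the difference of angles comes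
      from.\<close>
    have "((\<lambda>s. UY ((x, 0) + s *\<^sub>R e2) t) has_vector_derivative
        UY (0, 0) t ** cscale (inverse (of_real t)) (W (0, 0) 0 ** B (0, 0) ** adj2 (W (0, 0) 0))) (at 0)"
      using Y_y[OF O t] evY by (rule has_vector_derivative_transform_nhds)
    from vector_derivative_unique_at[OF this Y_y[OF p t]]
    have "cscale (inverse (of_real t)) (A ** B (x, 0) ** adj2 A) = cscale (inverse (of_real t)) (B (0, 0))"
      by (simp add: UY1[OF t] UY_0[OF t] W_0 A_def)
    then have "A ** B (x, 0) ** adj2 A = B (0, 0)"
      using t by (simp add: cmat2_eq_iff)
    then have A: "A $ 1 $ 1 ^ 2 = exp (- (\<i> * of_real (\<phi> (x, 0) - \<phi> (0, 0))))"
      "A $ 2 $ 2 ^ 2 = exp (\<i> * of_real (\<phi> (x, 0) - \<phi> (0, 0)))"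
      unfolding B_def diagonal_conj_antidiagonal[OF A_diag]
      by (auto simp: cmat2_eq_iff exp_minus exp_diff right_diff_distrib field_simps)
    have "((\<lambda>s. UX ((x, y) + s *\<^sub>R e1) t) has_vector_derivative
        UX (x, 0) t ** cscale (of_real t) (A ** P ** adj2 A)) (at 0)"
      using X_x[OF p t] evX unfolding AV by (rule has_vector_derivative_transform_nhds)
    then have "partial_x UX (x, y) t = UX (x, y) t ** cscale (of_real t) (A ** P ** adj2 A)"
      using eventually_nhds_x_imp_x[OF evX] unfolding partial_x_along e1_def
      by (simp add: vector_derivative_at)
    then show ?thesis
      by (simp add: inv_mult detUX[OF q t] P_def diagonal_conj_antidiagonal[OF A_diag] A)
         (simp add: cmat2_eq_iff)
  qed

  \<comment> \<open>The angle over the y-axis\<close>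
  have eq_y: "matrix_inv (UY (x, y) t) ** partial_y UY (x, y) t =
      cscale (- (\<i> / (2 * of_real t)))
        (mat2 0 (exp (\<i> * of_real (\<phi> (0, y)))) (exp (- (\<i> * of_real (\<phi> (0, y))))) 0)"
    if over: "over_y_axis D UX UY x y" and t: "t \<noteq> 0" for x y t
  proof -
    have p: "(0, y) \<in> D" and q: "(x, y) \<in> D"
      and evY: "\<forall>\<^sub>F h in nhds 0. UY ((x, y) + h *\<^sub>R e2) t = UY ((0, y) + h *\<^sub>R e2) t"
      and evX: "\<forall>\<^sub>F h in nhds 0. UX ((0, y) + h *\<^sub>R e1) t = UX ((0, 0) + h *\<^sub>R e1) t"
      using local_y[OF that] by auto
    have UX1: "UX (0, y) s = mat 1" if "s \<noteq> 0" for s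
      using local_y[OF over that] UX_0[OF that] by (auto dest: eventually_nhds_x_imp_x)
    define A where "A = V (0, y) 0"
    have AW: "W (0, y) 0 = A" and A_diag: "A $ 1 $ 2 = 0 \<and> A $ 2 $ 1 = 0"
      using W_eq_V_y[OF p UX1] V(3)[OF p] by (auto simp: A_def)
    \<comment> \<open>Here the compared coefficient is the constant matrix \<open>P\<close>, so the
      squares are 1 and the angle on the axis enters unchanged, with no value at the origin
      subtracted.\<close>
    have "((\<lambda>s. UX ((0, y) + s *\<^sub>R e1) t) has_vector_derivative
        UX (0, 0) t ** cscale (of_real t) (V (0, 0) 0 ** P ** adj2 (V (0, 0) 0))) (at 0)"
      using X_x[OF O t] evX by (rule has_vector_derivative_transform_nhds)
    from vector_derivative_unique_at[OF this X_x[OF p t]]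
    have "cscale (of_real t) (A ** P ** adj2 A) = cscale (of_real t) P"
      by (simp add: UX1[OF t] UX_0[OF t] V_0 A_def)
    then have "A ** P ** adj2 A = P"
      using t by (simp add: cmat2_eq_iff)
    then have A: "A $ 1 $ 1 ^ 2 = 1" "A $ 2 $ 2 ^ 2 = 1"
      unfolding P_def diagonal_conj_antidiagonal[OF A_diag] by (auto simp: cmat2_eq_iff)
    have "((\<lambda>s. UY ((x, y) + s *\<^sub>R e2) t) has_vector_derivative
        UY (0, y) t ** cscale (inverse (of_real t)) (A ** B (0, y) ** adj2 A)) (at 0)"
      using Y_y[OF p t] evY unfolding AW by (rule has_vector_derivative_transform_nhds)
    then have "partial_y UY (x, y) t = UY (x, y) t ** cscale (inverse (of_real t)) (A ** B (0, y) ** adj2 A)"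
      using eventually_nhds_x_imp_x[OF evY] unfolding partial_y_along e2_def
      by (simp add: vector_derivative_at)
    then show ?thesis
      using t by (simp add: inv_mult detUY[OF q t] B_def diagonal_conj_antidiagonal[OF A_diag] A)
         (simp add: cmat2_eq_iff field_simps)
  qed

  \<comment> \<open>Independence of the other coordinate along segments in the domain\<close>
  have ind_y: "indep_of_y (closed_segment (x, y) (x, y')) UX"
    if seg: "closed_segment (x, y) (x, y') \<subseteq> D" for x y y'
    unfolding indep_of_y_def
  proof (intro allI impI)
    fix a b b' t assume in_seg: "(a, b) \<in> closed_segment (x, y) (x, y')"
      "(a, b') \<in> closed_segment (x, y) (x, y')" and t: "t \<noteq> (0 :: real)"
    have "closed_segment (a, b) (a, b') \<subseteq> D"
      using subset_closed_segment[of "(a, b)" "(a, b')"] in_seg seg by blast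
    then have "closed_segment (a, b) ((a, b) + (b' - b) *\<^sub>R e2) \<subseteq> D"
      by (simp add: e2_def)
    from const_along[of D "\<lambda>q. UX q t", OF X_y[OF _ t] this]
    show "UX (a, b) t = UX (a, b') t" by (simp add: e2_def)
  qed
  have ind_x: "indep_of_x (closed_segment (x, y) (x', y)) UY"
    if seg: "closed_segment (x, y) (x', y) \<subseteq> D" for x x' y
    unfolding indep_of_x_def
  proof (intro allI impI)
    fix a a' b t assume in_seg: "(a, b) \<in> closed_segment (x, y) (x', y)"
      "(a', b) \<in> closed_segment (x, y) (x', y)" and t: "t \<noteq> (0 :: real)"
    have "closed_segment (a, b) (a', b) \<subseteq> D"
      using subset_closed_segment[of "(a, b)" "(a', b)"] in_seg seg by blast
    then have "closed_segment (a, b) ((a, b) + (a' - a) *\<^sub>R e1) \<subseteq> D"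
      by (simp add: e1_def)
    from const_along[of D "\<lambda>q. UY q t", OF Y_x[OF _ t] this]
    show "UY (a, b) t = UY (a', b) t" by (simp add: e1_def)
  qed
  show ?thesis
    using ind_y ind_x eq_x eq_y by (simp add: Let_def)
qed

end
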